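(* For every $n\ge2$ there exist constants $\varepsilon_D=\varepsilon_D(n)>0$ and $C_D=C_D(n)<\infty$, independent of the codimension $k\ge1$, with the following property. Let $\mathfrak m=n+k$, let $L\cong\mathbb H^n\subset\mathbb H^{\mathfrak m}$ be totally geodesic, let $p\in L$, and let $V$ be a stationary integral $n$-varifold in $B_{3/2}(p)$. If $$\operatorname{supp}V\cap B_{3/2}(p)\subset\{x\in\mathbb H^{\mathfrak m}:\operatorname{dist}_{\mathbb H}(x,L)<\varepsilon_D\},$$ then $$\mu_V\bigl(B_{5/4}(p)\bigr)\le C_D\,\mu_V\bigl(B_{1/4}(p)\bigr).$$
   Context: $n\ge2$, $k\ge1$, $\mathfrak m=n+k$. $\mathbb H^{\mathfrak m}$ is hyperbolic space of constant curvature $-1$; $B_s(p)$ is the open hyperbolic ball of radius $s$ about $p$ in $\mathbb H^{\mathfrak m}$. An integral $n$-varifold $V$ in an open set $U$ is the Radon measure on the Grassmann bundle $G_n(U)$ induced by a countably $n$-rectifiable set with integer-valued density; $\mu_V=\|V\|$ is its weight measure. $V$ is stationary in $U$ if $\int_{G_n(U)}\operatorname{div}_SX(x)\,dV(x,S)=0$ for every compactly supported $C^1$ vector field $X$ on $U$. $\operatorname{supp}V$ means the support of $\mu_V$. *)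

theory Defs
  imports "HOL-Analysis.Analysis"
begin

text \<open>
  Hyperbolic space of dimension \<open>m\<close> is realised as the hyperboloid in Minkowski space
  of dimension \<open>m + 1\<close> (coordinates \<open>0, \<dots>, m\<close>, with \<open>0\<close> the time-like one). The dimension is an explicit
  natural number, because a single statement has to range over all codimensions: vectors are
  functions on \<^typ>\<open>nat\<close> that vanish beyond \<open>m\<close>. On these finite-dimensional coordinate
  subspaces the product topology of \<^typ>\<open>nat \<Rightarrow> real\<close> is the usual Euclidean topology.
\<close>

subsection \<open>Hyperbolic space\<close>

definition mink :: "nat \<Rightarrow> (nat \<Rightarrow> real) set" where
  "mink m = {x. \<forall>i>m. x i = 0}"

definition flat :: "(nat \<Rightarrow> real) \<Rightarrow> nat \<Rightarrow> real" where
  "flat v i = (if i = 0 then - v i else v i)"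

definition lorentz :: "nat \<Rightarrow> (nat \<Rightarrow> real) \<Rightarrow> (nat \<Rightarrow> real) \<Rightarrow> real" where
  "lorentz m v w = (\<Sum>i\<le>m. flat v i * w i)"

definition hyp :: "nat \<Rightarrow> (nat \<Rightarrow> real) set" where
  "hyp m = {x \<in> mink m. lorentz m x x = -1 \<and> x 0 > 0}"

definition hdist :: "nat \<Rightarrow> (nat \<Rightarrow> real) \<Rightarrow> (nat \<Rightarrow> real) \<Rightarrow> real" where
  "hdist m x y = arcosh (- lorentz m x y)"

definition hball :: "nat \<Rightarrow> real \<Rightarrow> (nat \<Rightarrow> real) \<Rightarrow> (nat \<Rightarrow> real) set" where
  "hball m s p = {x \<in> hyp m. hdist m p x < s}"

definition hdist_set :: "nat \<Rightarrow> (nat \<Rightarrow> real) \<Rightarrow> (nat \<Rightarrow> real) set \<Rightarrow> real" where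
  "hdist_set m x A = (INF y\<in>A. hdist m x y)"

text \<open>The Lorentz form restricted to a tangent space is positive definite; it is the Riemannian
  metric.\<close>

definition tangent :: "nat \<Rightarrow> (nat \<Rightarrow> real) \<Rightarrow> (nat \<Rightarrow> real) set" where
  "tangent m x = {v \<in> mink m. lorentz m x v = 0}"

definition hnorm :: "nat \<Rightarrow> (nat \<Rightarrow> real) \<Rightarrow> real" where
  "hnorm m v = sqrt (lorentz m v v)"

text \<open>Riemannian exponential map; for \<open>v = 0\<close> the second summand is \<open>0\<close>, so the value is \<open>x\<close>.\<close>

definition hexp :: "nat \<Rightarrow> (nat \<Rightarrow> real) \<Rightarrow> (nat \<Rightarrow> real) \<Rightarrow> (nat \<Rightarrow> real)" where
  "hexp m x v = (\<lambda>i. cosh (hnorm m v) * x i + sinh (hnorm m v) / hnorm m v * v i)"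

text \<open>A totally geodesic copy of \<open>n\<close>-dimensional hyperbolic space: it contains the complete ambient
  geodesic through any two of its points, and with the ambient distance it is isometric to the
  model space. (On such a set ambient and intrinsic distance coincide.)\<close>

definition totally_geodesic_hyp :: "nat \<Rightarrow> nat \<Rightarrow> (nat \<Rightarrow> real) set \<Rightarrow> bool" where
  "totally_geodesic_hyp n m L \<longleftrightarrow>
     L \<subseteq> hyp m \<and>
     (\<forall>x\<in>L. \<forall>v\<in>tangent m x. hexp m x v \<in> L \<longrightarrow> (\<forall>t::real. hexp m x (\<lambda>i. t * v i) \<in> L)) \<and>
     (\<exists>f. f ` hyp n = L \<and> (\<forall>x\<in>hyp n. \<forall>y\<in>hyp n. hdist m (f x) (f y) = hdist n x y))"

subsection \<open>Hausdorff measure\<close>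

definition ediam :: "('a \<Rightarrow> 'a \<Rightarrow> real) \<Rightarrow> 'a set \<Rightarrow> ennreal" where
  "ediam d A = (SUP x\<in>A. SUP y\<in>A. ennreal (d x y))"

text \<open>The usual normalisation is used, for which the \<open>n\<close>-dimensional measure of an \<open>n\<close>-dimensional
  submanifold is its Riemannian volume. Only \<open>n \<ge> 1\<close> is intended, so that empty covering sets
  contribute \<open>0\<close>.\<close>

definition hausdorff_pre ::
  "nat \<Rightarrow> 'a set \<Rightarrow> ('a \<Rightarrow> 'a \<Rightarrow> real) \<Rightarrow> real \<Rightarrow> 'a set \<Rightarrow> ennreal" where
  "hausdorff_pre n \<Omega> d \<delta> A =
     (INF C\<in>{C :: nat \<Rightarrow> 'a set. A \<subseteq> (\<Union>i. C i) \<and> (\<forall>i. C i \<subseteq> \<Omega> \<and> ediam d (C i) \<le> ennreal \<delta>)}.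
        \<Sum>i. ennreal (unit_ball_vol (real n)) * (ediam d (C i) / 2) ^ n)"

definition hausdorff_outer ::
  "nat \<Rightarrow> 'a set \<Rightarrow> ('a \<Rightarrow> 'a \<Rightarrow> real) \<Rightarrow> 'a set \<Rightarrow> ennreal" where
  "hausdorff_outer n \<Omega> d A = (SUP \<delta>\<in>{0<..}. hausdorff_pre n \<Omega> d \<delta> A)"

text \<open>The measure lives on all Caratheodory-measurable sets, hence is complete.\<close>

definition hausdorff_measure :: "nat \<Rightarrow> 'a set \<Rightarrow> ('a \<Rightarrow> 'a \<Rightarrow> real) \<Rightarrow> 'a measure" where
  "hausdorff_measure n \<Omega> d =
     measure_of \<Omega> (lambda_system \<Omega> (Pow \<Omega>) (hausdorff_outer n \<Omega> d)) (hausdorff_outer n \<Omega> d)"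

abbreviation hyp_hausdorff :: "nat \<Rightarrow> nat \<Rightarrow> (nat \<Rightarrow> real) measure" where
  "hyp_hausdorff n m \<equiv> hausdorff_measure n (hyp m) (hdist m)"

subsection \<open>The Grassmann bundle\<close>

definition frame :: "nat \<Rightarrow> nat \<Rightarrow> (nat \<Rightarrow> real) \<Rightarrow> (nat \<Rightarrow> nat \<Rightarrow> real) \<Rightarrow> bool" where
  "frame n m x e \<longleftrightarrow>
     (\<forall>i<n. e i \<in> tangent m x) \<and>
     (\<forall>i<n. \<forall>j<n. lorentz m (e i) (e j) = (if i = j then 1 else 0))"

text \<open>An \<open>n\<close>-plane \<open>S\<close> in a tangent space is encoded by the matrix of the orthogonal projection
  onto it, \<open>v \<mapsto> \<Sum>i<n. \<langle>e i, v\<rangle> e i\<close> for any orthonormal basis \<open>e\<close> of \<open>S\<close>. This gives the Grassmann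
  bundle its usual topology as a subspace of a space of points and matrices.\<close>

definition plane_proj :: "nat \<Rightarrow> (nat \<Rightarrow> nat \<Rightarrow> real) \<Rightarrow> (nat \<Rightarrow> nat \<Rightarrow> real)" where
  "plane_proj n e = (\<lambda>a b. \<Sum>i<n. e i a * flat (e i) b)"

definition mat_app :: "nat \<Rightarrow> (nat \<Rightarrow> nat \<Rightarrow> real) \<Rightarrow> (nat \<Rightarrow> real) \<Rightarrow> (nat \<Rightarrow> real)" where
  "mat_app m P v = (\<lambda>a. \<Sum>b\<le>m. P a b * v b)"

definition grassmann_bundle ::
  "nat \<Rightarrow> nat \<Rightarrow> (nat \<Rightarrow> real) set \<Rightarrow> ((nat \<Rightarrow> real) \<times> (nat \<Rightarrow> nat \<Rightarrow> real)) set" where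
  "grassmann_bundle n m U = {(x, P). x \<in> U \<and> (\<exists>e. frame n m x e \<and> P = plane_proj n e)}"

subsection \<open>Rectifiable sets and integral varifolds\<close>

definition eucl_dist :: "nat \<Rightarrow> (nat \<Rightarrow> real) \<Rightarrow> (nat \<Rightarrow> real) \<Rightarrow> real" where
  "eucl_dist n x y = sqrt (\<Sum>i<n. (x i - y i)\<^sup>2)"

text \<open>Up to a null set, \<open>M\<close> is covered by countably many Lipschitz images of subsets of
  \<open>n\<close>-dimensional Euclidean space.\<close>

definition countably_rectifiable :: "nat \<Rightarrow> nat \<Rightarrow> (nat \<Rightarrow> real) set \<Rightarrow> bool" where
  "countably_rectifiable n m M \<longleftrightarrow>
     M \<in> sets (hyp_hausdorff n m) \<and>
     (\<exists>N A F. N \<in> null_sets (hyp_hausdorff n m) \<and>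
        M \<subseteq> N \<union> (\<Union>j::nat. F j ` A j) \<and>
        (\<forall>j. A j \<subseteq> {x. \<forall>i\<ge>n. x i = 0} \<and> F j ` A j \<subseteq> hyp m \<and>
             (\<exists>K. \<forall>x\<in>A j. \<forall>y\<in>A j. hdist m (F j x) (F j y) \<le> K * eucl_dist n x y)))"

text \<open>Points \<open>hexp m x v\<close> whose direction \<open>v\<close> makes a small angle with the plane encoded by \<open>P\<close>.\<close>

definition hcone ::
  "nat \<Rightarrow> (nat \<Rightarrow> real) \<Rightarrow> (nat \<Rightarrow> nat \<Rightarrow> real) \<Rightarrow> real \<Rightarrow> (nat \<Rightarrow> real) set" where
  "hcone m x P s =
     {hexp m x v | v. v \<in> tangent m x \<and> hnorm m (\<lambda>i. v i - mat_app m P v i) \<le> s * hnorm m v}"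

text \<open>Approximate tangent plane in the measure-theoretic sense: positive upper density at \<open>x\<close>, and
  the part of \<open>M\<close> outside any cone around the plane has density zero at \<open>x\<close>. For rectifiable sets of
  locally finite measure it exists and is unique at almost every point.\<close>

definition approx_tangent_plane ::
  "nat \<Rightarrow> nat \<Rightarrow> (nat \<Rightarrow> real) set \<Rightarrow> (nat \<Rightarrow> real) \<Rightarrow> (nat \<Rightarrow> nat \<Rightarrow> real) \<Rightarrow> bool" where
  "approx_tangent_plane n m M x P \<longleftrightarrow>
     (x, P) \<in> grassmann_bundle n m (hyp m) \<and>
     Limsup (at_right 0)
       (\<lambda>r. emeasure (hyp_hausdorff n m) (M \<inter> hball m r x) / ennreal (r ^ n)) > 0 \<and>
     (\<forall>s. 0 < s \<and> s < 1 \<longrightarrow>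
        ((\<lambda>r. emeasure (hyp_hausdorff n m) (M \<inter> hball m r x - hcone m x P s) / ennreal (r ^ n))
           \<longlongrightarrow> 0) (at_right 0))"

text \<open>\<open>M\<close> is the carrier, \<open>\<theta>\<close> the positive integer density and \<open>T\<close> the tangent plane map, which is
  determined almost everywhere. The induced measure \<open>V\<close> satisfies
  \<open>V(B) = \<integral> \<theta>\<close> over \<open>{x \<in> M. (x, T x) \<in> B}\<close> with respect to Hausdorff measure.\<close>

definition integral_varifold ::
  "nat \<Rightarrow> nat \<Rightarrow> (nat \<Rightarrow> real) set \<Rightarrow>
   ((nat \<Rightarrow> real) \<times> (nat \<Rightarrow> nat \<Rightarrow> real)) measure \<Rightarrow> bool" where
  "integral_varifold n m U V \<longleftrightarrow>
     (\<exists>M (\<theta> :: (nat \<Rightarrow> real) \<Rightarrow> nat) T.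
        countably_rectifiable n m M \<and> M \<subseteq> U \<and>
        \<theta> \<in> measurable (restrict_space (hyp_hausdorff n m) M) (count_space UNIV) \<and>
        (\<forall>x\<in>M. \<theta> x \<ge> 1) \<and>
        (\<lambda>x. (x, T x)) \<in> measurable (restrict_space (hyp_hausdorff n m) M)
                             (restrict_space borel (grassmann_bundle n m U)) \<and>
        (AE x in restrict_space (hyp_hausdorff n m) M. approx_tangent_plane n m M x (T x)) \<and>
        V = distr (density (restrict_space (hyp_hausdorff n m) M) (\<lambda>x. of_nat (\<theta> x)))
              (restrict_space borel (grassmann_bundle n m U)) (\<lambda>x. (x, T x))) \<and>
     (\<forall>K. compact K \<and> K \<subseteq> grassmann_bundle n m U \<longrightarrow> emeasure V K < \<infinity>)"

definition weight_measure ::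
  "(nat \<Rightarrow> real) set \<Rightarrow> ((nat \<Rightarrow> real) \<times> (nat \<Rightarrow> nat \<Rightarrow> real)) measure \<Rightarrow> (nat \<Rightarrow> real) measure"
where
  "weight_measure U V = distr V (restrict_space borel U) fst"

definition measure_support :: "'a::topological_space measure \<Rightarrow> 'a set" where
  "measure_support \<mu> =
     {x \<in> space \<mu>. \<forall>W. open W \<and> x \<in> W \<longrightarrow> emeasure \<mu> (W \<inter> space \<mu>) > 0}"

subsection \<open>Stationarity\<close>

text \<open>\<open>F\<close> is continuously differentiable on the (relatively open) subset \<open>W\<close> of Minkowski space:
  all partial derivatives exist and are continuous.\<close>

definition C1_on :: "nat \<Rightarrow> (nat \<Rightarrow> real) set \<Rightarrow> ((nat \<Rightarrow> real) \<Rightarrow> (nat \<Rightarrow> real)) \<Rightarrow> bool" where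
  "C1_on m W F \<longleftrightarrow>
     (\<forall>i\<le>m. \<forall>j\<le>m. \<exists>D. continuous_on W D \<and>
        (\<forall>x\<in>W. ((\<lambda>t. F (x(i := t)) j) has_real_derivative D x) (at (x i))))"

text \<open>Being \<open>C\<^sup>1\<close> on the open subset \<open>U\<close> of the hyperboloid means having a \<open>C\<^sup>1\<close> extension to an
  open neighbourhood in Minkowski space.\<close>

definition C1_vector_field_cpt ::
  "nat \<Rightarrow> (nat \<Rightarrow> real) set \<Rightarrow> ((nat \<Rightarrow> real) \<Rightarrow> (nat \<Rightarrow> real)) \<Rightarrow> bool" where
  "C1_vector_field_cpt m U X \<longleftrightarrow>
     (\<forall>x\<in>U. X x \<in> tangent m x) \<and>
     (\<exists>W F. open W \<and> U \<subseteq> W \<and> C1_on m (W \<inter> mink m) F \<and> (\<forall>x\<in>U. F x = X x)) \<and>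
     (\<exists>K. compact K \<and> K \<subseteq> U \<and> (\<forall>x\<in>U - K. X x = (\<lambda>i. 0)))"

text \<open>Levi-Civita connection of the hyperboloid: the derivative of \<open>X\<close> along the geodesic with
  initial velocity \<open>v\<close>, projected to the tangent space at \<open>x\<close>.\<close>

definition hcov ::
  "nat \<Rightarrow> ((nat \<Rightarrow> real) \<Rightarrow> (nat \<Rightarrow> real)) \<Rightarrow> (nat \<Rightarrow> real) \<Rightarrow> (nat \<Rightarrow> real) \<Rightarrow> (nat \<Rightarrow> real)" where
  "hcov m X x v =
     (let w = (\<lambda>j. deriv (\<lambda>t::real. X (hexp m x (\<lambda>i. t * v i)) j) 0)
      in (\<lambda>j. w j + lorentz m x w * x j))"

text \<open>Divergence \<open>\<Sum>i<n. \<langle>\<nabla>\<^bsub>e i\<^esub> X, e i\<rangle>\<close> over an orthonormal basis of the plane encoded by \<open>P\<close>; for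
  \<open>C\<^sup>1\<close> fields it does not depend on the chosen basis.\<close>

definition plane_div ::
  "nat \<Rightarrow> nat \<Rightarrow> ((nat \<Rightarrow> real) \<Rightarrow> (nat \<Rightarrow> real)) \<Rightarrow>
   (nat \<Rightarrow> real) \<times> (nat \<Rightarrow> nat \<Rightarrow> real) \<Rightarrow> real" where
  "plane_div n m X = (\<lambda>(x, P).
     let e = (SOME e. frame n m x e \<and> P = plane_proj n e)
     in \<Sum>i<n. lorentz m (hcov m X x (e i)) (e i))"

definition stationary ::
  "nat \<Rightarrow> nat \<Rightarrow> (nat \<Rightarrow> real) set \<Rightarrow>
   ((nat \<Rightarrow> real) \<times> (nat \<Rightarrow> nat \<Rightarrow> real)) measure \<Rightarrow> bool" where
  "stationary n m U V \<longleftrightarrow>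
     (\<forall>X. C1_vector_field_cpt m U X \<longrightarrow> integral\<^sup>L V (plane_div n m X) = 0)"

end

theory Submission
  imports Defs
begin

text \<open>
  Let \<open>c = cosh dist(p, \<cdot>)\<close>, let \<open>q\<close> be the squared length of the component tangential to \<open>L\<close> and
  \<open>s = sinh\<^sup>2 dist(\<cdot>, L)\<close>, so that \<open>c\<^sup>2 = 1 + q + s\<close>. For suitable constants \<open>N\<close>, \<open>A\<close>, \<open>B\<close> depending on
  \<open>n\<close> only, the function \<open>G = exp (- N q) + A s - B\<close> has, at points near \<open>L\<close> outside \<open>B\<^bsub>1/4\<^esub>(p)\<close>, a
  Hessian whose trace over every \<open>n\<close>-plane is positive. Since linear functions on the
  hyperboloid have Hessian proportional to the metric, this reduces to Bessel inequalities, and the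
  codimension does not enter. If the tube around \<open>L\<close> is thin, \<open>G\<close> is positive on \<open>B\<^bsub>5/4\<^esub>(p)\<close> and
  negative near the boundary of \<open>B\<^bsub>3/2\<^esub>(p)\<close> within the tube, so \<open>X = max(0, G)\<^sup>2 \<nabla>G\<close>, times a
  cutoff in \<open>c\<close> that within the tube only acts where \<open>G \<le> 0\<close>, is an admissible field. By
  convexity of \<open>t \<mapsto> max(0, t)\<^sup>3\<close> its divergence is nonnegative along the varifold
  outside \<open>B\<^bsub>1/4\<^esub>\<close>, bounded below by a positive constant on \<open>B\<^bsub>5/4\<^esub> - B\<^bsub>1/4\<^esub>\<close> and by
  a negative one on \<open>B\<^bsub>1/4\<^esub>\<close>; stationarity gives the inequality.
\<close>

subsection \<open>Lorentz geometry\<close>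

lemma lorentz_commute: "lorentz m v w = lorentz m w v"
  unfolding lorentz_def by (rule sum.cong) (auto simp: flat_def)

lemma lorentz_add_left: "lorentz m (\<lambda>i. v i + w i) u = lorentz m v u + lorentz m w u"
  unfolding lorentz_def flat_def sum.distrib[symmetric]
  by (rule sum.cong) (auto simp: algebra_simps)

lemma lorentz_diff_left: "lorentz m (\<lambda>i. v i - w i) u = lorentz m v u - lorentz m w u"
  unfolding lorentz_def flat_def sum_subtractf[symmetric]
  by (rule sum.cong) (auto simp: algebra_simps)

lemma lorentz_scale_left: "lorentz m (\<lambda>i. a * v i) u = a * lorentz m v u"
  unfolding lorentz_def flat_def sum_distrib_left
  by (rule sum.cong) (auto simp: algebra_simps)

lemma lorentz_sum_left: "lorentz m (\<lambda>i. \<Sum>k\<in>I. f k i) u = (\<Sum>k\<in>I. lorentz m (f k) u)"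
proof -
  have "lorentz m (\<lambda>i. \<Sum>k\<in>I. f k i) u = (\<Sum>i\<le>m. \<Sum>k\<in>I. flat (f k) i * u i)"
    unfolding lorentz_def by (rule sum.cong) (auto simp: flat_def sum_negf sum_distrib_right)
  also have "\<dots> = (\<Sum>k\<in>I. lorentz m (f k) u)"
    unfolding lorentz_def by (rule sum.swap)
  finally show ?thesis .
qed

lemma lorentz_add_right: "lorentz m u (\<lambda>i. v i + w i) = lorentz m u v + lorentz m u w"
  by (simp add: lorentz_commute[of m u] lorentz_add_left)

lemma lorentz_diff_right: "lorentz m u (\<lambda>i. v i - w i) = lorentz m u v - lorentz m u w"
  by (simp add: lorentz_commute[of m u] lorentz_diff_left)

lemma lorentz_scale_right: "lorentz m u (\<lambda>i. a * v i) = a * lorentz m u v"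
  by (simp add: lorentz_commute[of m u] lorentz_scale_left)

lemma lorentz_sum_right: "lorentz m u (\<lambda>i. \<Sum>k\<in>I. f k i) = (\<Sum>k\<in>I. lorentz m u (f k))"
  by (simp add: lorentz_commute[of m u] lorentz_sum_left)

lemmas lorentz_linear = lorentz_add_left lorentz_diff_left lorentz_scale_left lorentz_sum_left
  lorentz_add_right lorentz_diff_right lorentz_scale_right lorentz_sum_right

lemma lorentz_split: "lorentz m v w = (\<Sum>i\<in>{1..m}. v i * w i) - v 0 * w 0"
proof -
  have "{..m} = insert 0 {1..m}" by auto
  then show ?thesis by (simp add: lorentz_def flat_def)
qed

text \<open>With \<open>?S\<close> the product of spatial parts, the hypotheses read
  \<open>?S x x = x 0 * x 0 - 1\<close> and \<open>?S x v = x 0 * v 0\<close>, so the Euclidean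
  Cauchy-Schwarz inequality bounds \<open>v 0\<close> by the spatial length of \<open>v\<close>. If
  \<open>?S x x = 0\<close>, it forces \<open>v 0 = 0\<close>.\<close>

lemma lorentz_orthogonal_nonneg:
  assumes x: "lorentz m x x = -1" and v: "lorentz m x v = 0"
  shows "0 \<le> lorentz m v v"
proof -
  let ?S = "\<lambda>a b. \<Sum>i\<in>{1..m}. a i * b i"
  have cs: "(?S x v)\<^sup>2 \<le> ?S x x * ?S v v"
    using Cauchy_Schwarz_ineq_sum[of x v "{1..m}"] by (simp add: power2_eq_square)
  have x0: "?S x x = x 0 * x 0 - 1" and xv: "?S x v = x 0 * v 0"
    using x v by (auto simp: lorentz_split)
  have nn: "0 \<le> ?S x x" "0 \<le> ?S v v" by (auto intro!: sum_nonneg)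
  have "?S x x * (?S v v - v 0 * v 0) \<ge> (v 0)\<^sup>2"
    using cs unfolding xv x0 by (simp add: algebra_simps power2_eq_square)
  then have *: "0 \<le> ?S x x * (?S v v - v 0 * v 0)" by (rule order_trans[OF zero_le_power2])
  have "0 \<le> ?S v v - v 0 * v 0"
  proof (cases "?S x x = 0")
    case True
    then have "(x 0 * v 0)\<^sup>2 \<le> 0" "x 0 \<noteq> 0" using cs xv x0 by auto
    then show ?thesis using nn by simp
  next
    case False
    then show ?thesis using * nn by (simp add: zero_le_mult_iff)
  qed
  then show ?thesis by (simp add: lorentz_split)
qed

text \<open>The projection \<open>w\<close> of \<open>v\<close> to the span of \<open>e\<close> has
  equal products with \<open>v\<close> and with itself, and \<open>v - w\<close> is still orthogonal
  to the time-like \<open>x\<close>, where the form is nonnegative. The bounds in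
  \<open>frame_estimates\<close> all rest on this inequality.\<close>

lemma bessel_ineq:
  assumes x: "lorentz m x x = -1" and e: "frame n m x e" and v: "lorentz m x v = 0"
  shows "(\<Sum>l<n. (lorentz m (e l) v)\<^sup>2) \<le> lorentz m v v"
proof -
  define w where "w = (\<lambda>j. \<Sum>l<n. lorentz m (e l) v * e l j)"
  have xe: "lorentz m x (e l) = 0" if "l < n" for l
    using e that by (auto simp: frame_def tangent_def)
  have ee: "lorentz m (e i) (e j) = (if i = j then 1 else 0)" if "i < n" "j < n" for i j
    using e that by (auto simp: frame_def)
  have "lorentz m w v = (\<Sum>l<n. (lorentz m (e l) v)\<^sup>2)"
    by (simp add: w_def lorentz_linear power2_eq_square)
  moreover have "lorentz m w w = (\<Sum>l<n. (lorentz m (e l) v)\<^sup>2)"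
    by (simp add: w_def lorentz_linear power2_eq_square ee if_distrib sum.delta cong: if_cong)
  moreover have "lorentz m x (\<lambda>j. v j - w j) = 0"
    by (simp add: w_def lorentz_linear v xe)
  then have "0 \<le> lorentz m (\<lambda>j. v j - w j) (\<lambda>j. v j - w j)"
    by (rule lorentz_orthogonal_nonneg[OF x])
  ultimately show ?thesis
    by (simp add: lorentz_linear lorentz_commute[of m v w])
qed

lemma hyp_x0_ge1:
  assumes "x \<in> hyp m" shows "1 \<le> x 0"
proof -
  have "0 \<le> (\<Sum>i\<in>{1..m}. x i * x i)" by (auto intro!: sum_nonneg)
  then have "1 \<le> x 0 * x 0" using assms by (auto simp: hyp_def lorentz_split)
  then have "1\<^sup>2 \<le> (x 0)\<^sup>2" by (simp add: power2_eq_square)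
  then show ?thesis using assms by (intro power2_le_imp_le[of 1 "x 0"]) (auto simp: hyp_def)
qed

lemma hyp_abs_coord_le:
  assumes "x \<in> hyp m" shows "\<bar>x i\<bar> \<le> x 0"
proof (cases "i \<in> {1..m}")
  case True
  then have "x i * x i \<le> (\<Sum>i\<in>{1..m}. x i * x i)"
    by (intro member_le_sum) auto
  also have "\<dots> \<le> x 0 * x 0" using assms by (auto simp: hyp_def lorentz_split)
  finally show ?thesis using assms
    by (auto simp: hyp_def abs_le_square_iff[symmetric] power2_eq_square[symmetric])
next
  case False
  then show ?thesis using assms hyp_x0_ge1[OF assms]
    by (cases "i = 0") (auto simp: hyp_def mink_def)
qed

text \<open>Spatial Cauchy-Schwarz gives \<open>x0^2 + p0^2 + c^2 - 1 <= 2 p0 x0 c\<close> for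
  \<open>c = - lorentz m p x\<close>. The first bound makes hyperbolic balls bounded in coordinates,
  the second puts \<open>c\<close> into the domain of \<open>arcosh\<close>.\<close>

lemma hyp_x0_bound:
  assumes x: "x \<in> hyp m" and p: "p \<in> hyp m"
  shows "x 0 \<le> 2 * p 0 * (- lorentz m p x)" and "1 \<le> - lorentz m p x"
proof -
  let ?S = "\<lambda>a b. \<Sum>i\<in>{1..m}. a i * b i"
  let ?c = "- lorentz m p x"
  have x1: "1 \<le> x 0" and p1: "1 \<le> p 0" using hyp_x0_ge1 x p by auto
  have cs: "(?S p x)\<^sup>2 \<le> ?S p p * ?S x x"
    using Cauchy_Schwarz_ineq_sum[of p x "{1..m}"] by (simp add: power2_eq_square)
  have sx: "?S x x = x 0 * x 0 - 1" and sp: "?S p p = p 0 * p 0 - 1"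
    using x p by (auto simp: hyp_def lorentz_split)
  have c: "?S p x = p 0 * x 0 - ?c" by (simp add: lorentz_split)
  have *: "(p 0 * x 0 - ?c)\<^sup>2 \<le> (p 0 * p 0 - 1) * (x 0 * x 0 - 1)"
    using cs unfolding sx sp c .
  have px: "p 0 * x 0 \<ge> 1" using mult_mono[OF p1 x1] x1 p1 by simp
  have "(p 0 * x 0 - ?c)\<^sup>2 \<le> (p 0 * x 0 - 1)\<^sup>2"
  proof -
    have "(p 0 * p 0 - 1) * (x 0 * x 0 - 1) = (p 0 * x 0 - 1)\<^sup>2 - (p 0 - x 0)\<^sup>2"
      by (simp add: power2_eq_square algebra_simps)
    then show ?thesis using * zero_le_power2[of "p 0 - x 0"] by linarith
  qed
  then have "\<bar>p 0 * x 0 - ?c\<bar> \<le> \<bar>p 0 * x 0 - 1\<bar>" by (simp add: abs_le_square_iff)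
  then show c1: "1 \<le> ?c" using px by linarith
  have "2 * p 0 * x 0 * ?c \<ge> x 0 * x 0 + p 0 * p 0 + ?c\<^sup>2 - 1"
    using * by (simp add: power2_eq_square algebra_simps)
  moreover have "p 0 * p 0 \<ge> 1" using mult_mono[OF p1 p1] p1 by simp
  ultimately have "x 0 * x 0 \<le> x 0 * (2 * p 0 * ?c)"
    using zero_le_power2[of ?c] unfolding mult.left_commute[of "x 0"] mult.assoc by linarith
  then show "x 0 \<le> 2 * p 0 * ?c" using x1 by (meson mult_le_cancel_left_pos zero_less_one less_le_trans)
qed

lemma hdist_less_iff:
  assumes "x \<in> hyp m" "p \<in> hyp m" "0 \<le> s"
  shows "hdist m p x < s \<longleftrightarrow> - lorentz m p x < cosh s"
proof -
  have "hdist m p x < s \<longleftrightarrow> cosh (hdist m p x) < cosh s"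
    using hyp_x0_bound(2)[OF assms(1,2)] assms(3)
    by (subst cosh_real_nonneg_less_iff) (auto simp: hdist_def arcosh_nonneg_real)
  then show ?thesis using hyp_x0_bound(2)[OF assms(1,2)] by (simp add: hdist_def)
qed

section \<open>Orthonormal frames adapted to a totally geodesic subspace\<close>

text \<open>\<open>u\<close> is the image of the standard spatial basis under the Lorentz boost that
  takes the time-like basis vector to \<open>x\<close>. Its \<open>n\<close> members span the
  tangent space, so the second claim is Parseval's identity for the tangential part of
  \<open>y\<close>, combined with \<open>lorentz n y y = -1\<close>.\<close>

lemma boost_frame:
  assumes x: "x \<in> hyp n"
  shows "\<exists>u. frame n n x u \<and>
    (\<forall>y\<in>hyp n. (\<Sum>i<n. (lorentz n (u i) y)\<^sup>2) = (lorentz n x y)\<^sup>2 - 1)"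
proof -
  define \<delta> :: "nat \<Rightarrow> nat \<Rightarrow> real" where "\<delta> = (\<lambda>i j. if j = i then 1 else 0)"
  define u where "u = (\<lambda>i j. \<delta> (Suc i) j + x (Suc i) / (1 + x 0) * (x j + \<delta> 0 j))"
  have x1: "1 \<le> x 0" using hyp_x0_ge1[OF x] .
  have dl: "lorentz n (\<delta> i) w = (if i = 0 then - w 0 else w i)" if "i \<le> n" for i w
  proof -
    have "lorentz n (\<delta> i) w = (\<Sum>j\<le>n. if j = i then (if i = 0 then - w 0 else w i) else 0)"
      unfolding lorentz_def by (rule sum.cong) (auto simp: flat_def \<delta>_def)
    then show ?thesis using that by simp
  qed
  have dr: "lorentz n w (\<delta> i) = (if i = 0 then - w 0 else w i)" if "i \<le> n" for i w
    using dl[OF that] by (simp add: lorentz_commute[of n w])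
  have xx: "lorentz n x x = -1" and xm: "x \<in> mink n" using x by (auto simp: hyp_def)
  have ux: "lorentz n x (u i) = 0" if "i < n" for i
    using that x1 unfolding u_def lorentz_add_right lorentz_scale_right
    by (simp add: dr xx) (simp add: field_simps)
  have uu: "lorentz n (u i) (u j) = (if i = j then 1 else 0)" if "i < n" "j < n" for i j
  proof -
    have "lorentz n (u i) (u j) = lorentz n (\<delta> (Suc i)) (u j) +
        x (Suc i) / (1 + x 0) * (lorentz n x (u j) + lorentz n (\<delta> 0) (u j))"
      by (subst u_def) (simp only: lorentz_add_left lorentz_scale_left)
    also have "\<dots> = u j (Suc i) - x (Suc i) / (1 + x 0) * u j 0"
      using that ux by (simp add: dl)
    also have "\<dots> = (if i = j then 1 else 0)"
    proof -
      have "u j 0 = x (Suc j)" using x1 by (simp add: u_def \<delta>_def add.commute)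
      then show ?thesis by (simp add: u_def \<delta>_def mult.commute)
    qed
    finally show ?thesis .
  qed
  have um: "u i \<in> mink n" if "i < n" for i
    using that xm by (auto simp: u_def mink_def \<delta>_def)
  have fr: "frame n n x u"
    using ux uu um by (auto simp: frame_def tangent_def)
  have "(\<Sum>i<n. (lorentz n (u i) y)\<^sup>2) = (lorentz n x y)\<^sup>2 - 1" if y: "y \<in> hyp n" for y
  proof -
    let ?S = "\<lambda>a b. \<Sum>i\<in>{1..n}. a i * b i"
    define b where "b = lorentz n x y"
    define r where "r = (b - y 0) / (1 + x 0)"
    have r: "r * (1 + x 0) = b - y 0" using x1 by (simp add: r_def)
    have "lorentz n (u i) y = y (Suc i) + x (Suc i) * r" if "i < n" for i
      using that unfolding u_def lorentz_add_left lorentz_scale_left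
      by (simp add: dl b_def r_def)
    then have "(\<Sum>i<n. (lorentz n (u i) y)\<^sup>2) = (\<Sum>i<n. (y (Suc i) + x (Suc i) * r)\<^sup>2)"
      by (intro sum.cong) auto
    also have "\<dots> = (\<Sum>i\<in>{1..n}. (y i + x i * r)\<^sup>2)"
      by (rule sum.reindex_bij_witness[of _ "\<lambda>i. i - 1" Suc]) auto
    also have "\<dots> = ?S y y + 2 * r * ?S x y + r\<^sup>2 * ?S x x"
      unfolding sum_distrib_left sum.distrib[symmetric]
      by (rule sum.cong) (auto simp: power2_eq_square algebra_simps)
    also have "?S y y = y 0 * y 0 - 1" using y by (auto simp: hyp_def lorentz_split)
    also have "?S x x = x 0 * x 0 - 1" using x by (auto simp: hyp_def lorentz_split)
    also have "?S x y = b + x 0 * y 0" by (simp add: b_def lorentz_split)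
    also have "y 0 * y 0 - 1 + 2 * r * (b + x 0 * y 0) + r\<^sup>2 * (x 0 * x 0 - 1)
       = y 0 * y 0 - 1 + r * (2 * (b + x 0 * y 0) + (r * (1 + x 0)) * (x 0 - 1))"
      by (simp add: power2_eq_square algebra_simps)
    also have "2 * (b + x 0 * y 0) + (r * (1 + x 0)) * (x 0 - 1) = (1 + x 0) * (b + y 0)"
      unfolding r by (simp add: algebra_simps)
    also have "y 0 * y 0 - 1 + r * ((1 + x 0) * (b + y 0))
       = y 0 * y 0 - 1 + (r * (1 + x 0)) * (b + y 0)"
      by (simp only: mult.assoc)
    also have "\<dots> = b\<^sup>2 - 1"
      unfolding r by (simp add: power2_eq_square algebra_simps)
    finally show ?thesis by (simp add: b_def)
  qed
  with fr show ?thesis by blast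
qed

text \<open>If \<open>u\<close> is orthonormal at \<open>x\<close>, the points \<open>\<surd>2 x + u i\<close> again lie on the hyperboloid, so an
  isometry transports the frame \<open>u\<close> although it is only defined on points.\<close>

lemma totally_geodesic_frame:
  assumes L: "totally_geodesic_hyp n m L" and p: "p \<in> L"
  shows "\<exists>e. frame n m p e \<and>
    (\<forall>y\<in>L. (\<Sum>i<n. (lorentz m (e i) y)\<^sup>2) = (lorentz m p y)\<^sup>2 - 1)"
proof -
  from L obtain f where f: "f ` hyp n = L"
    and iso: "\<And>x y. x \<in> hyp n \<Longrightarrow> y \<in> hyp n \<Longrightarrow> hdist m (f x) (f y) = hdist n x y"
    and Lh: "L \<subseteq> hyp m"
    by (auto simp: totally_geodesic_hyp_def)
  have fh: "f x \<in> hyp m" if "x \<in> hyp n" for x using f Lh that by auto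
  have ff: "lorentz m (f x) (f y) = lorentz n x y" if "x \<in> hyp n" "y \<in> hyp n" for x y
  proof -
    have "cosh (hdist m (f x) (f y)) = cosh (hdist n x y)" using iso that by simp
    then show ?thesis
      using hyp_x0_bound(2)[OF fh fh, OF that(2,1)] hyp_x0_bound(2)[OF that(2,1)]
      by (simp add: hdist_def)
  qed
  obtain x where x: "x \<in> hyp n" and px: "p = f x" using p f by auto
  obtain u where u: "frame n n x u"
    and uP: "\<And>y. y \<in> hyp n \<Longrightarrow> (\<Sum>i<n. (lorentz n (u i) y)\<^sup>2) = (lorentz n x y)\<^sup>2 - 1"
    using boost_frame[OF x] by blast
  have xx: "lorentz n x x = -1" and xm: "x \<in> mink n" using x by (auto simp: hyp_def)
  have um: "u i \<in> mink n" and xu: "lorentz n x (u i) = 0" if "i < n" for i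
    using u that by (auto simp: frame_def tangent_def)
  have uu: "lorentz n (u i) (u j) = (if i = j then 1 else 0)" if "i < n" "j < n" for i j
    using u that by (auto simp: frame_def)
  define a where "a = (\<lambda>i j. sqrt 2 * x j + u i j)"
  have aa: "lorentz n (a i) (a j) = (if i = j then 1 else 0) - 2" if "i < n" "j < n" for i j
    using that by (simp add: a_def lorentz_linear xx xu uu lorentz_commute[of n "u i" x])
  have xa: "lorentz n x (a i) = - sqrt 2" if "i < n" for i
    using that by (simp add: a_def lorentz_linear xx xu)
  have ah: "a i \<in> hyp n" if i: "i < n" for i
  proof -
    \<comment> \<open>Otherwise \<open>- a i\<close> would lie on the hyperboloid and have product
      \<open>sqrt 2\<close> with \<open>x\<close>, whereas two points of the hyperboloid have
      product at most -1.\<close>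
    have "0 < a i 0"
    proof (rule ccontr)
      assume neg: "\<not> 0 < a i 0"
      define b where "b = (\<lambda>j. - 1 * a i j)"
      have b1: "lorentz n b b = -1" using aa[OF i i] unfolding b_def lorentz_scale_left lorentz_scale_right by simp
      have "0 \<le> (\<Sum>k\<in>{1..n}. b k * b k)" by (auto intro!: sum_nonneg)
      then have "b 0 * b 0 \<ge> 1" using b1 by (simp add: lorentz_split)
      moreover have "b 0 \<ge> 0" using neg by (simp add: b_def)
      ultimately have "b 0 > 0" by (cases "b 0 = 0") auto
      moreover have "b \<in> mink n" using um[OF i] xm by (auto simp: b_def a_def mink_def)
      ultimately have "b \<in> hyp n" using b1 by (auto simp: hyp_def)
      then have "1 \<le> - lorentz n x b" using hyp_x0_bound(2) x by blast
      moreover have "lorentz n x b = sqrt 2"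
        using xa[OF i] unfolding b_def lorentz_scale_right by simp
      ultimately show False using real_sqrt_gt_zero[of 2] by linarith
    qed
    moreover have "a i \<in> mink n" using um[OF i] xm by (auto simp: a_def mink_def)
    ultimately show ?thesis using aa[OF i i] by (simp add: hyp_def)
  qed
  define e where "e = (\<lambda>i j. f (a i) j - sqrt 2 * p j)"
  have pp: "lorentz m p p = -1" and pm: "p \<in> mink m" using p Lh by (auto simp: hyp_def)
  have pa: "lorentz m p (f (a i)) = - sqrt 2" if "i < n" for i
    using that by (simp add: px ff x ah xa)
  have ee: "lorentz m (e i) (e j) = (if i = j then 1 else 0)" if "i < n" "j < n" for i j
    using that
    by (simp add: e_def lorentz_linear pp pa lorentz_commute[of m "f _" p] ff ah aa)
  have pe: "lorentz m p (e i) = 0" if "i < n" for i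
    using that by (simp add: e_def lorentz_linear pp pa)
  have em: "e i \<in> mink m" if "i < n" for i
    using fh[OF ah[OF that]] pm by (auto simp: e_def hyp_def mink_def)
  have fr: "frame n m p e" using ee pe em by (auto simp: frame_def tangent_def)
  have "(\<Sum>i<n. (lorentz m (e i) y)\<^sup>2) = (lorentz m p y)\<^sup>2 - 1" if y: "y \<in> L" for y
  proof -
    obtain w where w: "w \<in> hyp n" "y = f w" using y f by auto
    have "lorentz m (e i) y = lorentz n (u i) w" if "i < n" for i
    proof -
      have "lorentz m (e i) y = lorentz n (a i) w - sqrt 2 * lorentz n x w"
        using that w by (simp add: e_def lorentz_linear px ff ah x)
      also have "\<dots> = lorentz n (u i) w" by (simp add: a_def lorentz_linear)
      finally show ?thesis .
    qed
    then have "(\<Sum>i<n. (lorentz m (e i) y)\<^sup>2) = (\<Sum>i<n. (lorentz n (u i) w)\<^sup>2)"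
      by (intro sum.cong) auto
    then show ?thesis using uP[OF w(1)] w by (simp add: px ff x)
  qed
  with fr show ?thesis by blast
qed

text \<open>The left-hand side is the squared hyperbolic cosine of the distance from
  \<open>x\<close> to \<open>L\<close>. For a nearby \<open>y\<close> in \<open>L\<close> the part
  \<open>w y\<close> normal to \<open>p\<close> and \<open>e\<close> is null, hence orthogonal to
  \<open>w x\<close>, so \<open>lorentz m x y\<close> depends only on the coordinates along
  \<open>p\<close> and \<open>e\<close>. Cauchy-Schwarz in these coordinates gives the
  bound.\<close>

lemma near_totally_geodesic:
  assumes x: "x \<in> hyp m" and p: "p \<in> L" and Lh: "L \<subseteq> hyp m" and e: "frame n m p e"
    and eL: "\<And>y. y \<in> L \<Longrightarrow> (\<Sum>i<n. (lorentz m (e i) y)\<^sup>2) = (lorentz m p y)\<^sup>2 - 1"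
    and d: "hdist_set m x L < \<epsilon>" and "0 \<le> \<epsilon>"
  shows "(lorentz m p x)\<^sup>2 - (\<Sum>i<n. (lorentz m (e i) x)\<^sup>2) < (cosh \<epsilon>)\<^sup>2"
proof -
  have "bdd_below (hdist m x ` L)"
    by (rule bdd_belowI[of _ 0])
       (use hyp_x0_bound(2)[OF _ x] Lh in \<open>auto simp: hdist_def intro!: arcosh_nonneg_real\<close>)
  then obtain y where y: "y \<in> L" and dy: "hdist m x y < \<epsilon>"
    using d p cINF_less_iff[of L "hdist m x" \<epsilon>] by (auto simp: hdist_set_def)
  have yh: "y \<in> hyp m" and ph: "p \<in> hyp m" using y p Lh by auto
  have b: "- lorentz m x y < cosh \<epsilon>" using hdist_less_iff[OF yh x] dy assms(7) by auto
  have b1: "1 \<le> - lorentz m x y" using hyp_x0_bound(2)[OF yh x] .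
  have pp: "lorentz m p p = -1" using ph by (auto simp: hyp_def)
  have pe: "lorentz m p (e i) = 0" if "i < n" for i
    using e that by (auto simp: frame_def tangent_def)
  have ee: "lorentz m (e i) (e j) = (if i = j then 1 else 0)" if "i < n" "j < n" for i j
    using e that by (auto simp: frame_def)
  define w where "w = (\<lambda>v j. v j + lorentz m p v * p j - (\<Sum>i<n. lorentz m (e i) v * e i j))"
  have pw: "lorentz m p (w v) = 0" for v
    by (simp add: w_def lorentz_linear pp pe)
  have ew: "lorentz m (e i) (w v) = 0" if "i < n" for i v
    using that by (simp add: w_def lorentz_linear ee pe lorentz_commute[of m "e i" p] if_distrib cong: if_cong)
  have ww: "lorentz m (w u) (w v) = lorentz m u v + lorentz m p u * lorentz m p v
      - (\<Sum>i<n. lorentz m (e i) u * lorentz m (e i) v)" for u v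
  proof -
    have "lorentz m (w u) (w v) = lorentz m u (w v)"
      by (subst w_def) (simp add: lorentz_linear pw ew)
    also have "\<dots> = lorentz m u v + lorentz m p u * lorentz m p v
      - (\<Sum>i<n. lorentz m (e i) u * lorentz m (e i) v)"
      by (simp add: w_def lorentz_linear lorentz_commute[of m u] mult.commute[of _ "lorentz m _ u"])
    finally show ?thesis .
  qed
  have wy: "lorentz m (w y) (w y) = 0"
    using eL[OF y] yh by (simp add: ww power2_eq_square hyp_def)
  have wxy: "lorentz m (w x) (w y) = 0"
  proof (rule ccontr)
    assume nz: "lorentz m (w x) (w y) \<noteq> 0"
    \<comment> \<open>The value for which \<open>w x + t * w y\<close> has square -1. This
      contradicts semidefiniteness, under which a null vector is orthogonal to everything.\<close>
    define t where "t = - (lorentz m (w x) (w x) + 1) / (2 * lorentz m (w x) (w y))"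
    have "lorentz m p (\<lambda>j. w x j + t * w y j) = 0" by (simp add: lorentz_linear pw)
    then have "0 \<le> lorentz m (\<lambda>j. w x j + t * w y j) (\<lambda>j. w x j + t * w y j)"
      by (rule lorentz_orthogonal_nonneg[OF pp])
    also have "\<dots> = lorentz m (w x) (w x) + t * (2 * lorentz m (w x) (w y))"
      by (simp add: lorentz_linear wy lorentz_commute[of m "w y" "w x"] algebra_simps)
    also have "\<dots> = -1" using nz by (simp add: t_def)
    finally show False by simp
  qed
  define c d T q where "c = lorentz m p x" and "d = lorentz m p y"
    and "T = (\<Sum>i<n. lorentz m (e i) x * lorentz m (e i) y)"
    and "q = (\<Sum>i<n. (lorentz m (e i) x)\<^sup>2)"
  have xy: "lorentz m x y = T - c * d"
    using wxy by (simp add: ww c_def d_def T_def)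
  have T: "T\<^sup>2 \<le> q * (d\<^sup>2 - 1)"
    using Cauchy_Schwarz_ineq_sum[of "\<lambda>i. lorentz m (e i) x" "\<lambda>i. lorentz m (e i) y" "{..<n}"] eL[OF y]
    by (simp add: T_def q_def d_def)
  have q0: "0 \<le> q" by (auto simp: q_def intro!: sum_nonneg)
  have Q0: "0 \<le> d\<^sup>2 - 1" unfolding d_def eL[OF y, symmetric] by (auto intro!: sum_nonneg)
  have "c\<^sup>2 - q \<le> (T - c * d)\<^sup>2"
  proof (cases "d\<^sup>2 - 1 = 0")
    case True
    then have "T = 0" "d\<^sup>2 = 1" using T by auto
    then show ?thesis using q0 by (simp add: power_mult_distrib)
  next
    case False
    then have Q: "0 < d\<^sup>2 - 1" using Q0 by simp
    \<comment> \<open>Completing the square; the remaining summand is the defect in the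
      Cauchy-Schwarz inequality \<open>T\<close>.\<close>
    have "(d\<^sup>2 - 1) * ((T - c * d)\<^sup>2 - (c\<^sup>2 - q)) = ((d\<^sup>2 - 1) * c - d * T)\<^sup>2 + (q * (d\<^sup>2 - 1) - T\<^sup>2)"
      by (simp add: power2_eq_square algebra_simps)
    also have "\<dots> \<ge> 0" using T by simp
    finally show ?thesis using Q by (simp add: zero_le_mult_iff)
  qed
  also have "(T - c * d)\<^sup>2 = (- lorentz m x y)\<^sup>2" by (simp add: xy power2_commute)
  also have "\<dots> < (cosh \<epsilon>)\<^sup>2" using b b1 by (intro power_strict_mono) auto
  finally show ?thesis by (simp add: c_def q_def)
qed

subsection \<open>A class of continuously differentiable functions\<close>

text \<open>The square is the lowest integer power of the positive part that is continuously
  differentiable, which is the regularity that an admissible field needs.\<close>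

definition sqpart :: "real \<Rightarrow> real" where
  "sqpart t = (max 0 t)\<^sup>2"

lemma has_real_derivative_sqpart: "(sqpart has_real_derivative 2 * max 0 t) (at t)"
proof (cases "t = 0")
  case True
  have "((\<lambda>h. (sqpart (0 + h) - sqpart 0) / h) \<longlongrightarrow> 0) (at 0)"
  proof (rule Lim_null_comparison)
    show "\<forall>\<^sub>F h in at 0. norm ((sqpart (0 + h) - sqpart 0) / h) \<le> \<bar>h\<bar>"
      by (auto simp: sqpart_def max_def power2_eq_square intro!: always_eventually)
    show "((\<lambda>h::real. \<bar>h\<bar>) \<longlongrightarrow> 0) (at 0)"
      by (rule tendsto_rabs_zero) (rule tendsto_ident_at)
  qed
  then show ?thesis using True by (simp add: DERIV_def)
next
  case False
  show ?thesis
  proof (cases "t > 0")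
    case True
    have "((\<lambda>t. t\<^sup>2) has_real_derivative 2 * t) (at t)"
      by (auto intro!: derivative_eq_intros)
    then have "(sqpart has_real_derivative 2 * t) (at t)"
      by (rule has_field_derivative_transform_within_open[of _ _ _ "{0<..}"])
         (use True in \<open>auto simp: sqpart_def\<close>)
    then show ?thesis using True by simp
  next
    case neg: False
    have "((\<lambda>t. 0) has_real_derivative 0) (at t)" by simp
    then have "(sqpart has_real_derivative 0) (at t)"
      by (rule has_field_derivative_transform_within_open[of _ _ _ "{..<0}"])
         (use neg False in \<open>auto simp: sqpart_def\<close>)
    then show ?thesis using neg by simp
  qed
qed

lemma continuous_on_sqpart: "continuous_on S f \<Longrightarrow> continuous_on S (\<lambda>x. sqpart (f x))"
  unfolding sqpart_def by (intro continuous_intros)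

text \<open>A continuously differentiable cutoff built from \<open>sqpart\<close> alone: 0 for
  \<open>u <= 0\<close>, 1 for \<open>u >= 1\<close>, and \<open>1 - (1 - u^2)^2\<close> in
  between.\<close>

definition smoothstep :: "real \<Rightarrow> real" where
  "smoothstep u = 1 - sqpart (1 - sqpart u)"

definition smoothstep_deriv :: "real \<Rightarrow> real" where
  "smoothstep_deriv u = 2 * max 0 (1 - sqpart u) * (2 * max 0 u)"

lemma has_real_derivative_smoothstep:
  "(smoothstep has_real_derivative smoothstep_deriv u) (at u)"
proof -
  have "((\<lambda>u. sqpart (1 - sqpart u)) has_real_derivative
      2 * max 0 (1 - sqpart u) * (0 - 2 * max 0 u)) (at u)"
    by (rule DERIV_chain2[OF has_real_derivative_sqpart])
       (intro DERIV_diff DERIV_const has_real_derivative_sqpart)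
  then have "((\<lambda>u. 1 - sqpart (1 - sqpart u)) has_real_derivative
      0 - 2 * max 0 (1 - sqpart u) * (0 - 2 * max 0 u)) (at u)"
    by (intro DERIV_diff DERIV_const)
  then show ?thesis unfolding smoothstep_def[abs_def] smoothstep_deriv_def by simp
qed

lemma continuous_on_smoothstep_deriv:
  "continuous_on S f \<Longrightarrow> continuous_on S (\<lambda>x. smoothstep_deriv (f x))"
  unfolding smoothstep_deriv_def by (intro continuous_intros continuous_on_sqpart)

lemma continuous_on_smoothstep:
  "continuous_on S f \<Longrightarrow> continuous_on S (\<lambda>x. smoothstep (f x))"
  unfolding smoothstep_def by (intro continuous_intros continuous_on_sqpart)

lemma smoothstep_eq_0: "u \<le> 0 \<Longrightarrow> smoothstep u = 0" "u \<le> 0 \<Longrightarrow> smoothstep_deriv u = 0"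
  by (auto simp: smoothstep_def smoothstep_deriv_def sqpart_def)

lemma smoothstep_eq_1:
  assumes "1 \<le> u" shows "smoothstep u = 1" "smoothstep_deriv u = 0"
proof -
  have "1 \<le> sqpart u" using assms by (simp add: sqpart_def)
  then show "smoothstep u = 1" "smoothstep_deriv u = 0"
    by (auto simp: smoothstep_def smoothstep_deriv_def sqpart_def[of "1 - _"])
qed

text \<open>A global, scalar version of \<open>C1_on\<close>. Continuity of \<open>f\<close> is
  demanded separately: partial derivatives in the coordinates up to \<open>m\<close> do not control
  the dependence on later ones, and the product rule needs continuous factors.\<close>

definition C1_fun :: "nat \<Rightarrow> ((nat \<Rightarrow> real) \<Rightarrow> real) \<Rightarrow> bool" where
  "C1_fun m f \<longleftrightarrow> continuous_on UNIV f \<and>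
     (\<forall>i\<le>m. \<exists>D. continuous_on UNIV D \<and>
        (\<forall>x. ((\<lambda>t. f (x(i := t))) has_real_derivative D x) (at (x i))))"

lemma C1_fun_const: "C1_fun m (\<lambda>x. a)"
  unfolding C1_fun_def by (auto intro!: exI[of _ "\<lambda>x. 0"])

lemma C1_fun_coord: "C1_fun m (\<lambda>x. x k)"
  unfolding C1_fun_def
proof (intro conjI allI impI)
  show "continuous_on UNIV (\<lambda>x::nat \<Rightarrow> real. x k)" by (rule continuous_on_product_coordinates)
  fix i
  show "\<exists>D. continuous_on UNIV D \<and>
      (\<forall>x::nat \<Rightarrow> real. ((\<lambda>t. (x(i := t)) k) has_real_derivative D x) (at (x i)))"
    by (rule exI[of _ "\<lambda>x. if i = k then 1 else 0"]) auto
qed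

lemma C1_fun_add:
  assumes "C1_fun m f" "C1_fun m g" shows "C1_fun m (\<lambda>x. f x + g x)"
  unfolding C1_fun_def
proof (intro conjI allI impI)
  show "continuous_on UNIV (\<lambda>x. f x + g x)"
    using assms by (auto simp: C1_fun_def intro!: continuous_intros)
  fix i assume i: "i \<le> m"
  obtain D where D: "continuous_on UNIV D"
    "\<And>x. ((\<lambda>t. f (x(i := t))) has_real_derivative D x) (at (x i))"
    using assms(1) i unfolding C1_fun_def by blast
  obtain D' where D': "continuous_on UNIV D'"
    "\<And>x. ((\<lambda>t. g (x(i := t))) has_real_derivative D' x) (at (x i))"
    using assms(2) i unfolding C1_fun_def by blast
  show "\<exists>D. continuous_on UNIV D \<and>
      (\<forall>x. ((\<lambda>t. f (x(i := t)) + g (x(i := t))) has_real_derivative D x) (at (x i)))"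
    by (rule exI[of _ "\<lambda>x. D x + D' x"]) (use D D' in \<open>auto intro!: continuous_intros DERIV_add\<close>)
qed

lemma C1_fun_mult:
  assumes "C1_fun m f" "C1_fun m g" shows "C1_fun m (\<lambda>x. f x * g x)"
  unfolding C1_fun_def
proof (intro conjI allI impI)
  have fg: "continuous_on UNIV f" "continuous_on UNIV g"
    using assms by (auto simp: C1_fun_def)
  then show "continuous_on UNIV (\<lambda>x. f x * g x)" by (intro continuous_intros)
  fix i assume i: "i \<le> m"
  obtain D where D: "continuous_on UNIV D"
    "\<And>x. ((\<lambda>t. f (x(i := t))) has_real_derivative D x) (at (x i))"
    using assms(1) i unfolding C1_fun_def by blast
  obtain D' where D': "continuous_on UNIV D'"
    "\<And>x. ((\<lambda>t. g (x(i := t))) has_real_derivative D' x) (at (x i))"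
    using assms(2) i unfolding C1_fun_def by blast
  have "((\<lambda>t. f (x(i := t)) * g (x(i := t))) has_real_derivative D x * g x + D' x * f x) (at (x i))"
    for x using DERIV_mult[OF D(2)[of x] D'(2)[of x]] by simp
  then show "\<exists>D. continuous_on UNIV D \<and>
      (\<forall>x. ((\<lambda>t. f (x(i := t)) * g (x(i := t))) has_real_derivative D x) (at (x i)))"
    by (intro exI[of _ "\<lambda>x. D x * g x + D' x * f x"] conjI allI)
       (use fg D(1) D'(1) in \<open>auto intro!: continuous_intros\<close>)
qed

lemma C1_fun_sum:
  assumes "\<And>k. k \<in> I \<Longrightarrow> C1_fun m (f k)" shows "C1_fun m (\<lambda>x. \<Sum>k\<in>I. f k x)"
  using assms
  by (induction I rule: infinite_finite_induct) (auto intro: C1_fun_const C1_fun_add)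

lemma C1_fun_compose:
  assumes f: "C1_fun m f" and g: "\<And>t. (g has_real_derivative g' t) (at t)"
    and g': "continuous_on UNIV (\<lambda>x. g' (f x))"
  shows "C1_fun m (\<lambda>x. g (f x))"
  unfolding C1_fun_def
proof (intro conjI allI impI)
  have cf: "continuous_on UNIV f" using f by (simp add: C1_fun_def)
  have "continuous_on UNIV g"
    using g by (intro continuous_at_imp_continuous_on) (auto intro: DERIV_isCont)
  then show "continuous_on UNIV (\<lambda>x. g (f x))"
    using cf by (rule continuous_on_compose2) auto
  fix i assume i: "i \<le> m"
  obtain D where D: "continuous_on UNIV D"
    "\<And>x. ((\<lambda>t. f (x(i := t))) has_real_derivative D x) (at (x i))"
    using f i unfolding C1_fun_def by blast
  have "((\<lambda>t. g (f (x(i := t)))) has_real_derivative g' (f x) * D x) (at (x i))" for x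
    using DERIV_chain2[OF g D(2)[of x]] by simp
  then show "\<exists>D. continuous_on UNIV D \<and>
      (\<forall>x. ((\<lambda>t. g (f (x(i := t)))) has_real_derivative D x) (at (x i)))"
    by (intro exI[of _ "\<lambda>x. g' (f x) * D x"] conjI allI)
       (use g' D(1) in \<open>auto intro!: continuous_intros\<close>)
qed

lemma C1_fun_lorentz: "C1_fun m (lorentz m a)"
  unfolding lorentz_def[abs_def]
  by (intro C1_fun_sum C1_fun_mult C1_fun_const C1_fun_coord)

lemma C1_fun_power2: "C1_fun m f \<Longrightarrow> C1_fun m (\<lambda>x. (f x)\<^sup>2)"
  unfolding power2_eq_square by (rule C1_fun_mult)

lemma C1_fun_imp_continuous_on: "C1_fun m f \<Longrightarrow> continuous_on S f"
  unfolding C1_fun_def by (blast intro: continuous_on_subset)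

lemma C1_fun_exp: "C1_fun m f \<Longrightarrow> C1_fun m (\<lambda>x. exp (f x))"
  by (rule C1_fun_compose[of _ _ exp exp])
     (auto intro!: derivative_eq_intros continuous_intros dest: C1_fun_imp_continuous_on[of _ _ UNIV])

lemma C1_fun_sqpart: "C1_fun m f \<Longrightarrow> C1_fun m (\<lambda>x. sqpart (f x))"
  by (rule C1_fun_compose[of _ _ sqpart "\<lambda>t. 2 * max 0 t"])
     (auto intro!: has_real_derivative_sqpart continuous_intros dest: C1_fun_imp_continuous_on[of _ _ UNIV])

lemma C1_fun_smoothstep: "C1_fun m f \<Longrightarrow> C1_fun m (\<lambda>x. smoothstep (f x))"
  by (rule C1_fun_compose[of _ _ smoothstep smoothstep_deriv])
     (auto intro!: has_real_derivative_smoothstep continuous_on_smoothstep_deriv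
        dest: C1_fun_imp_continuous_on[of _ _ UNIV])

lemma C1_on_UNIV:
  assumes "\<And>j. j \<le> m \<Longrightarrow> C1_fun m (\<lambda>x. F x j)"
  shows "C1_on m S F"
  unfolding C1_on_def
proof (intro allI impI)
  fix i j assume "i \<le> m" "j \<le> m"
  then obtain D where "continuous_on UNIV D"
    "\<And>x. ((\<lambda>t. F (x(i := t)) j) has_real_derivative D x) (at (x i))"
    using assms[of j] unfolding C1_fun_def by blast
  then show "\<exists>D. continuous_on S D \<and>
      (\<forall>x\<in>S. ((\<lambda>t. F (x(i := t)) j) has_real_derivative D x) (at (x i)))"
    by (blast intro: continuous_on_subset)
qed

subsection \<open>The barrier field\<close>

lemma continuous_on_lorentz:
  assumes v: "\<And>i. continuous_on S (\<lambda>z. v z i)" and w: "\<And>i. continuous_on S (\<lambda>z. w z i)"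
  shows "continuous_on S (\<lambda>z. lorentz m (v z) (w z))"
proof -
  have "continuous_on S (\<lambda>z. flat (v z) i)" for i
    using v by (cases "i = 0") (auto simp: flat_def intro!: continuous_intros)
  then show ?thesis
    unfolding lorentz_def by (intro continuous_intros w) auto
qed

text \<open>For the projection to a plane this is a sum over any orthonormal basis of the plane.
  Written with matrix entries, it is continuous in \<open>P\<close> and involves no choice of
  basis.\<close>

definition trace_form ::
  "nat \<Rightarrow> (nat \<Rightarrow> nat \<Rightarrow> real) \<Rightarrow> (nat \<Rightarrow> real) \<Rightarrow> (nat \<Rightarrow> real) \<Rightarrow> real" where
  "trace_form m P a b = lorentz m a (mat_app m P b)"

lemma trace_form_plane_proj:
  "trace_form m (plane_proj n e) a b = (\<Sum>l<n. lorentz m a (e l) * lorentz m b (e l))"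
proof -
  have *: "mat_app m (plane_proj n e) b = (\<lambda>a. \<Sum>l<n. lorentz m (e l) b * e l a)"
    unfolding mat_app_def plane_proj_def lorentz_def
    by (rule ext) (simp add: sum_distrib_left sum_distrib_right sum.swap[of _ "{..<n}"] mult_ac)
  show ?thesis
    unfolding trace_form_def * lorentz_sum_right lorentz_scale_right
    by (simp add: lorentz_commute[of m b] mult.commute)
qed

lemma continuous_on_trace_form:
  assumes P: "\<And>a b. continuous_on S (\<lambda>z. P z a b)"
    and v: "\<And>i. continuous_on S (\<lambda>z. v z i)" and w: "\<And>i. continuous_on S (\<lambda>z. w z i)"
  shows "continuous_on S (\<lambda>z. trace_form m (P z) (v z) (w z))"
  unfolding trace_form_def mat_app_def
  by (intro continuous_on_lorentz v continuous_on_sum continuous_on_mult P w)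

text \<open>For negative \<open>t\<close> the signs in \<open>sinh\<close> and in the quotient
  cancel; for \<open>t = 0\<close> the quotient in \<open>hexp\<close> is division by zero, with
  value 0, and both sides are \<open>x\<close>.\<close>

lemma hexp_unit:
  assumes "lorentz m v v = 1"
  shows "hexp m x (\<lambda>i. t * v i) = (\<lambda>i. cosh t * x i + sinh t * v i)"
proof -
  have "hnorm m (\<lambda>i. t * v i) = \<bar>t\<bar>"
    using assms by (simp add: hnorm_def lorentz_linear real_sqrt_abs2)
  then show ?thesis
    by (cases "t \<ge> 0") (auto simp: hexp_def abs_if)
qed

text \<open>\<open>L\<close> enters only through the frame \<open>e\<close> of its tangent space at
  \<open>p\<close>. The cutoff drops from 1 to 0 while \<open>cc\<close> runs from \<open>c1\<close>
  to \<open>c2\<close>.\<close>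

locale barrier =
  fixes n m :: nat and p :: "nat \<Rightarrow> real" and e :: "nat \<Rightarrow> nat \<Rightarrow> real"
    and N A B c1 c2 :: real
  assumes p: "p \<in> hyp m" and e: "frame n m p e" and c12: "c1 < c2"
begin

text \<open>In the orthonormal coordinates given by \<open>p\<close>, \<open>e\<close> and the normals of \<open>L\<close>: \<open>cc\<close> is the hyperbolic
  cosine of the distance to \<open>p\<close>, \<open>hh\<close> the component along \<open>e\<close>, \<open>qq\<close> its squared length, and
  \<open>ss\<close> the squared length of the normal component, that is \<open>sinh\<^sup>2\<close> of the distance to \<open>L\<close>.
  \<open>al x * x + be x * hh x + ga x * p\<close> is the gradient of \<open>GG\<close> on the hyperboloid, and
  \<open>dv (x, P)\<close> is the divergence of \<open>XX\<close> along \<open>P\<close>.\<close>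

definition cc where "cc x = - lorentz m p x"
definition zz where "zz i = lorentz m (e i)"
definition hh where "hh x = (\<lambda>j. \<Sum>i<n. zz i x * e i j)"
definition qq where "qq x = (\<Sum>i<n. (zz i x)\<^sup>2)"
definition ss where "ss x = (cc x)\<^sup>2 - 1 - qq x"
definition EE where "EE x = exp (- N * qq x)"
definition GG where "GG x = EE x + A * ss x - B"
definition uu where "uu x = (c2 - cc x) / (c2 - c1)"
definition TT where "TT x = smoothstep (uu x) * sqpart (GG x)"
definition al where "al x = 2 * A * (cc x)\<^sup>2 - 2 * (N * EE x + A) * qq x"
definition be where "be x = - 2 * (N * EE x + A)"
definition ga where "ga x = - 2 * A * cc x"
definition XX where "XX x = (\<lambda>j. TT x * (al x * x j + be x * hh x j + ga x * p j))"
text \<open>Coefficients in the derivative of \<open>TT\<close>: along \<open>v\<close> it equals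
  \<open>S1 x * lorentz m p v\<close> plus \<open>S2 x\<close> times the derivative of
  \<open>GG\<close>. The first comes from the cutoff, the second from the truncation.\<close>

definition S1 where "S1 x = smoothstep_deriv (uu x) / (c2 - c1) * sqpart (GG x)"
definition S2 where "S2 x = smoothstep (uu x) * (2 * max 0 (GG x))"
definition dv where
  "dv z = (case z of (x, P) \<Rightarrow>
     S1 x * (be x * trace_form m P p (hh x) + ga x * trace_form m P p p)
     + S2 x * ((be x)\<^sup>2 * trace_form m P (hh x) (hh x)
         + 2 * be x * ga x * trace_form m P p (hh x) + (ga x)\<^sup>2 * trace_form m P p p)
     + TT x * (n * al x + 4 * N\<^sup>2 * EE x * trace_form m P (hh x) (hh x)
         + be x * (\<Sum>i<n. trace_form m P (e i) (e i)) + 2 * A * trace_form m P p p))"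

lemma pp: "lorentz m p p = -1" and p_mink: "p \<in> mink m"
  using p by (auto simp: hyp_def)

lemma pe: "i < n \<Longrightarrow> lorentz m p (e i) = 0" and e_mink: "i < n \<Longrightarrow> e i \<in> mink m"
  using e by (auto simp: frame_def tangent_def)

lemma ee: "i < n \<Longrightarrow> j < n \<Longrightarrow> lorentz m (e i) (e j) = (if i = j then 1 else 0)"
  using e by (auto simp: frame_def)

lemma hh_left: "lorentz m (hh x) v = (\<Sum>i<n. zz i x * zz i v)"
  by (simp add: hh_def lorentz_linear zz_def)

lemma hh_self: "lorentz m (hh x) x = qq x"
  by (simp add: hh_left qq_def power2_eq_square)

lemma e_hh: "i < n \<Longrightarrow> lorentz m (e i) (hh x) = zz i x"
  by (simp add: hh_def lorentz_linear ee if_distrib cong: if_cong)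

lemma hh_hh: "lorentz m (hh x) (hh x) = qq x"
  by (subst hh_left) (simp add: zz_def[of _ ] e_hh qq_def power2_eq_square)

lemma C1_cc: "C1_fun m cc"
proof -
  have "C1_fun m (\<lambda>x. (-1) * lorentz m p x)"
    by (intro C1_fun_mult C1_fun_const C1_fun_lorentz)
  then show ?thesis by (simp add: cc_def[abs_def])
qed

lemma C1_zz: "C1_fun m (zz i)"
  unfolding zz_def by (rule C1_fun_lorentz)

lemma C1_qq: "C1_fun m qq"
  unfolding qq_def[abs_def] by (intro C1_fun_sum C1_fun_power2 C1_zz)

lemma C1_EE: "C1_fun m EE"
  unfolding EE_def[abs_def] by (intro C1_fun_exp C1_fun_mult C1_fun_const C1_qq)

lemma C1_GG: "C1_fun m GG"
proof -
  have "C1_fun m (\<lambda>x. (EE x + A * (((cc x)\<^sup>2 + -1) + -1 * qq x)) + - B)"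
    by (intro C1_fun_add C1_fun_mult C1_fun_power2 C1_fun_const C1_EE C1_cc C1_qq)
  then show ?thesis by (simp add: GG_def[abs_def] ss_def)
qed

lemma C1_uu: "C1_fun m uu"
proof -
  have "C1_fun m (\<lambda>x. 1 / (c2 - c1) * (c2 + -1 * cc x))"
    by (intro C1_fun_add C1_fun_mult C1_fun_const C1_cc)
  then show ?thesis by (simp add: uu_def[abs_def])
qed

lemma C1_hh: "C1_fun m (\<lambda>x. hh x j)"
  unfolding hh_def by (intro C1_fun_sum C1_fun_mult C1_fun_const C1_zz)

lemma C1_al: "C1_fun m al"
proof -
  have "C1_fun m (\<lambda>x. (2 * A) * (cc x)\<^sup>2 + ((-2) * (N * EE x + A)) * qq x)"
    by (intro C1_fun_add C1_fun_mult C1_fun_power2 C1_fun_const C1_EE C1_cc C1_qq)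
  then show ?thesis unfolding al_def[abs_def] by (simp only: minus_mult_left[symmetric] diff_conv_add_uminus)
qed

lemma C1_be: "C1_fun m be"
  unfolding be_def[abs_def] by (intro C1_fun_add C1_fun_mult C1_fun_const C1_EE)

lemma C1_ga: "C1_fun m ga"
  unfolding ga_def[abs_def] by (intro C1_fun_add C1_fun_mult C1_fun_const C1_cc)

lemma C1_TT: "C1_fun m TT"
  unfolding TT_def[abs_def] by (intro C1_fun_mult C1_fun_smoothstep C1_fun_sqpart C1_uu C1_GG)

lemma C1_XX: "C1_fun m (\<lambda>x. XX x j)"
  unfolding XX_def
  by (intro C1_fun_add C1_fun_mult C1_fun_const C1_fun_coord C1_TT C1_al C1_be C1_ga C1_hh)

text \<open>\<open>be x * hh x + ga x * p\<close> is the ambient Lorentz gradient of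
  \<open>GG\<close>; \<open>al x\<close> is the multiple of \<open>x\<close> that makes the sum
  orthogonal to \<open>x\<close>.\<close>

lemma XX_tangent:
  assumes x: "x \<in> hyp m" shows "XX x \<in> tangent m x"
proof -
  have "XX x \<in> mink m"
    using x p_mink e_mink by (auto simp: XX_def mink_def hyp_def hh_def)
  moreover have "lorentz m x (XX x) = TT x * (- al x + be x * qq x - ga x * cc x)"
    using x hh_self[of x]
    by (simp add: XX_def lorentz_linear lorentz_commute[of m x "hh x"] lorentz_commute[of m x p]
        cc_def hyp_def)
  moreover have "- al x + be x * qq x - ga x * cc x = 0"
    by (simp add: al_def be_def ga_def power2_eq_square algebra_simps)
  ultimately show ?thesis by (simp add: tangent_def)
qed

text \<open>Differentiate along the geodesic \<open>g\<close>. Pairing with \<open>v\<close> kills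
  every multiple of \<open>x\<close>, so the derivative of \<open>al\<close> drops out. The factor
  of \<open>TT x\<close> is the Hessian of \<open>GG\<close> in direction \<open>v\<close>, and
  \<open>G'\<close> is the derivative of \<open>GG\<close>.\<close>

lemma deriv_XX:
  assumes xv: "lorentz m x v = 0" and vv: "lorentz m v v = 1"
  defines "G' \<equiv> be x * lorentz m (hh x) v + ga x * lorentz m p v"
  defines "w \<equiv> \<lambda>j. deriv (\<lambda>t. XX (hexp m x (\<lambda>i. t * v i)) j) 0"
  shows "lorentz m w v = (S1 x * lorentz m p v + S2 x * G') * G'
    + TT x * (al x + 4 * N\<^sup>2 * EE x * (lorentz m (hh x) v)\<^sup>2
        + be x * (\<Sum>i<n. (lorentz m (e i) v)\<^sup>2) + 2 * A * (lorentz m p v)\<^sup>2)"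
proof -
  define g where "g t = (\<lambda>i. cosh t * x i + sinh t * v i)" for t :: real
  have g0: "g 0 = x" by (simp add: g_def)
  have lin: "((\<lambda>t. lorentz m a (g t)) has_real_derivative lorentz m a v) (at 0)" for a
    unfolding g_def lorentz_add_right lorentz_scale_right
    by (auto intro!: derivative_eq_intros)
  have dj: "((\<lambda>t. g t j) has_real_derivative v j) (at 0)" for j
    unfolding g_def by (auto intro!: derivative_eq_intros)
  have dc: "((\<lambda>t. cc (g t)) has_real_derivative - lorentz m p v) (at 0)"
    unfolding cc_def by (intro DERIV_minus lin)
  have dz: "((\<lambda>t. zz i (g t)) has_real_derivative zz i v) (at 0)" for i
    unfolding zz_def by (rule lin)
  define hv pv where "hv = lorentz m (hh x) v" and "pv = lorentz m p v"
  have dq: "((\<lambda>t. qq (g t)) has_real_derivative 2 * hv) (at 0)"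
    unfolding qq_def hv_def hh_left sum_distrib_left
    by (rule DERIV_sum) (auto intro!: derivative_eq_intros dz simp: g0)
  have dE: "((\<lambda>t. EE (g t)) has_real_derivative - (2 * N * EE x * hv)) (at 0)"
    unfolding EE_def by (auto intro!: derivative_eq_intros dq simp: g0)
  have dG: "((\<lambda>t. GG (g t)) has_real_derivative G') (at 0)"
    unfolding GG_def ss_def
    by (auto intro!: derivative_eq_intros dq dE dc simp: g0 G'_def be_def ga_def hv_def algebra_simps)
  have du: "((\<lambda>t. uu (g t)) has_real_derivative pv / (c2 - c1)) (at 0)"
    unfolding uu_def using c12 by (auto intro!: derivative_eq_intros dc simp: pv_def)
  have ds: "((\<lambda>t. smoothstep (uu (g t))) has_real_derivative
      smoothstep_deriv (uu x) * (pv / (c2 - c1))) (at 0)"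
    using DERIV_chain2[OF has_real_derivative_smoothstep du] by (simp add: g0)
  have dp: "((\<lambda>t. sqpart (GG (g t))) has_real_derivative 2 * max 0 (GG x) * G') (at 0)"
    using DERIV_chain2[OF has_real_derivative_sqpart dG] by (simp add: g0)
  define T' where "T' = S1 x * pv + S2 x * G'"
  have dT: "((\<lambda>t. TT (g t)) has_real_derivative T') (at 0)"
    using DERIV_mult[OF ds dp] by (simp add: g0 T'_def TT_def S1_def S2_def algebra_simps)
  define al' where "al' = - (4 * A * cc x * pv) + 4 * N\<^sup>2 * EE x * hv * qq x - 4 * (N * EE x + A) * hv"
  have dal: "((\<lambda>t. al (g t)) has_real_derivative al') (at 0)"
    unfolding al_def
    by (auto intro!: derivative_eq_intros dq dE dc
        simp: g0 al'_def pv_def power2_eq_square algebra_simps)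
  have dbe: "((\<lambda>t. be (g t)) has_real_derivative 4 * N\<^sup>2 * EE x * hv) (at 0)"
    unfolding be_def by (auto intro!: derivative_eq_intros dE simp: power2_eq_square)
  have dga: "((\<lambda>t. ga (g t)) has_real_derivative 2 * A * pv) (at 0)"
    unfolding ga_def by (auto intro!: derivative_eq_intros dc simp: pv_def)
  have dh: "((\<lambda>t. hh (g t) j) has_real_derivative hh v j) (at 0)" for j
    unfolding hh_def by (rule DERIV_sum) (auto intro!: derivative_eq_intros dz)
  define w' where "w' = (\<lambda>j. T' * (al x * x j + be x * hh x j + ga x * p j)
      + TT x * ((al' * x j + al x * v j) + (4 * N\<^sup>2 * EE x * hv * hh x j + be x * hh v j)
          + 2 * A * pv * p j))"
  have "((\<lambda>t. XX (g t) j) has_real_derivative w' j) (at 0)" for j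
    unfolding XX_def
    by (rule derivative_eq_intros dT dal dbe dga dh dj refl)+
       (simp add: g0 w'_def algebra_simps)
  then have "w = w'"
    unfolding w_def hexp_unit[OF vv] g_def[symmetric] by (auto intro: DERIV_imp_deriv)
  have hvv: "lorentz m (hh v) v = (\<Sum>i<n. (lorentz m (e i) v)\<^sup>2)"
    by (simp add: hh_left zz_def power2_eq_square)
  have "lorentz m w v = T' * G' + TT x * (al x + (4 * N\<^sup>2 * EE x * hv * hv
      + be x * (\<Sum>i<n. (lorentz m (e i) v)\<^sup>2)) + 2 * A * pv * pv)"
    unfolding \<open>w = w'\<close> w'_def lorentz_add_left lorentz_scale_left xv vv hvv
      hv_def[symmetric] pv_def[symmetric] G'_def
    by simp
  then show ?thesis
    by (simp add: T'_def hv_def pv_def power2_eq_square)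
qed

text \<open>Summing \<open>deriv_XX\<close> over the frame picked by \<open>SOME\<close> leaves only
  traces over \<open>P\<close>, so the choice disappears. The normal correction in
  \<open>hcov\<close> is a multiple of \<open>x\<close> and is orthogonal to the frame.\<close>

lemma plane_div_XX:
  assumes z: "(x, P) \<in> grassmann_bundle n m (hyp m)"
  shows "plane_div n m XX (x, P) = dv (x, P)"
proof -
  define f where "f = (SOME f. frame n m x f \<and> P = plane_proj n f)"
  have "\<exists>f. frame n m x f \<and> P = plane_proj n f"
    using z by (auto simp: grassmann_bundle_def)
  then have "frame n m x f \<and> P = plane_proj n f"
    unfolding f_def by (rule someI_ex)
  then have f: "frame n m x f" and P: "P = plane_proj n f" by auto
  have xf: "lorentz m x (f l) = 0" and ff: "lorentz m (f l) (f l) = 1" if "l < n" for l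
    using f that by (auto simp: frame_def tangent_def)
  define H K R where "H l = lorentz m (hh x) (f l)" and "K l = lorentz m p (f l)"
    and "R l = (\<Sum>i<n. (lorentz m (e i) (f l))\<^sup>2)" for l
  have "plane_div n m XX (x, P) = (\<Sum>l<n. lorentz m (hcov m XX x (f l)) (f l))"
    by (simp add: plane_div_def f_def Let_def)
  also have "\<dots> = (\<Sum>l<n. (S1 x * K l + S2 x * (be x * H l + ga x * K l)) * (be x * H l + ga x * K l)
    + TT x * (al x + 4 * N\<^sup>2 * EE x * (H l)\<^sup>2 + be x * R l + 2 * A * (K l)\<^sup>2))"
  proof (rule sum.cong)
    fix l assume "l \<in> {..<n}"
    then have l: "l < n" by simp
    show "lorentz m (hcov m XX x (f l)) (f l) =
      (S1 x * K l + S2 x * (be x * H l + ga x * K l)) * (be x * H l + ga x * K l)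
      + TT x * (al x + 4 * N\<^sup>2 * EE x * (H l)\<^sup>2 + be x * R l + 2 * A * (K l)\<^sup>2)"
      unfolding H_def R_def K_def deriv_XX[OF xf[OF l] ff[OF l], symmetric]
      by (simp add: hcov_def Let_def lorentz_add_left lorentz_scale_left xf[OF l])
  qed simp
  also have "\<dots> = (\<Sum>l<n. S1 x * (be x * (K l * H l) + ga x * (K l * K l))
      + S2 x * ((be x)\<^sup>2 * (H l * H l) + 2 * be x * ga x * (K l * H l) + (ga x)\<^sup>2 * (K l * K l))
      + TT x * (al x + 4 * N\<^sup>2 * EE x * (H l * H l) + be x * R l + 2 * A * (K l * K l)))"
    by (rule sum.cong) (auto simp: power2_eq_square algebra_simps)
  also have "\<dots> = S1 x * (be x * (\<Sum>l<n. K l * H l) + ga x * (\<Sum>l<n. K l * K l))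
      + S2 x * ((be x)\<^sup>2 * (\<Sum>l<n. H l * H l) + 2 * be x * ga x * (\<Sum>l<n. K l * H l)
          + (ga x)\<^sup>2 * (\<Sum>l<n. K l * K l))
      + TT x * (n * al x + 4 * N\<^sup>2 * EE x * (\<Sum>l<n. H l * H l) + be x * (\<Sum>l<n. R l)
          + 2 * A * (\<Sum>l<n. K l * K l))"
    by (simp add: sum.distrib sum_distrib_left[symmetric])
  also have "(\<Sum>l<n. R l) = (\<Sum>i<n. trace_form m P (e i) (e i))"
    unfolding R_def P trace_form_plane_proj power2_eq_square by (rule sum.swap)
  finally show ?thesis
    by (simp add: dv_def P trace_form_plane_proj H_def K_def)
qed

end

section \<open>Estimates for the trace of the Hessian and for the divergence\<close>

context barrier
begin

text \<open>Bessel's inequality for the frame \<open>f\<close> applied to the gradients of the coordinates \<open>zz i\<close>, for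
  \<open>e\<close> applied to the vectors \<open>f l\<close>, and for \<open>f\<close> applied to the angular parts
  \<open>e i - (zz i x / qq x) hh x\<close>, which are tangent to the hyperboloid at \<open>x\<close>.\<close>

lemma frame_estimates:
  fixes H K Z :: real
  assumes x: "x \<in> hyp m" and f: "frame n m x f"
  defines "H \<equiv> \<Sum>l<n. (lorentz m (hh x) (f l))\<^sup>2"
    and "K \<equiv> \<Sum>l<n. (lorentz m p (f l))\<^sup>2"
    and "Z \<equiv> \<Sum>i<n. \<Sum>l<n. (lorentz m (e i) (f l))\<^sup>2"
  shows "Z \<le> n + qq x" "Z \<le> n + K" "0 < qq x \<Longrightarrow> Z \<le> real n - 1 + H / qq x"
proof -
  have xx: "lorentz m x x = -1" using x by (auto simp: hyp_def)
  have xf: "lorentz m x (f l) = 0" "lorentz m (f l) x = 0" if "l < n" for l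
    using f that by (auto simp: frame_def tangent_def lorentz_commute[of m "f l" x])
  have ff: "lorentz m (f l) (f l) = 1" if "l < n" for l
    using f that by (auto simp: frame_def)
  have xe: "lorentz m x (e i) = zz i x" "lorentz m (e i) x = zz i x" for i
    by (simp_all add: zz_def lorentz_commute)
  have "(\<Sum>l<n. (lorentz m (e i) (f l))\<^sup>2) \<le> 1 + (zz i x)\<^sup>2" if "i < n" for i
  proof -
    define v where "v = (\<lambda>j. e i j + zz i x * x j)"
    have "(\<Sum>l<n. (lorentz m (f l) v)\<^sup>2) \<le> lorentz m v v"
      by (rule bessel_ineq[OF xx f]) (simp add: v_def lorentz_linear xe xx)
    also have "lorentz m v v = 1 + (zz i x)\<^sup>2"
      using that by (simp add: v_def lorentz_linear xe xx ee power2_eq_square)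
    also have "(\<Sum>l<n. (lorentz m (f l) v)\<^sup>2) = (\<Sum>l<n. (lorentz m (e i) (f l))\<^sup>2)"
      by (rule sum.cong)
         (auto simp: v_def lorentz_linear xf lorentz_commute[of m "f _" "e i"])
    finally show ?thesis .
  qed
  then have "Z \<le> (\<Sum>i<n. 1 + (zz i x)\<^sup>2)" unfolding Z_def by (intro sum_mono) auto
  then show "Z \<le> n + qq x" by (simp add: sum.distrib qq_def)
  have "(\<Sum>i<n. (lorentz m (e i) (f l))\<^sup>2) \<le> 1 + (lorentz m p (f l))\<^sup>2" if "l < n" for l
  proof -
    define v where "v = (\<lambda>j. f l j + lorentz m p (f l) * p j)"
    have "(\<Sum>i<n. (lorentz m (e i) v)\<^sup>2) \<le> lorentz m v v"
      by (rule bessel_ineq[OF pp e]) (simp add: v_def lorentz_linear pp)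
    also have "lorentz m v v = 1 + (lorentz m p (f l))\<^sup>2"
      using that by (simp add: v_def lorentz_linear pp ff power2_eq_square lorentz_commute[of m "f l" p])
    also have "(\<Sum>i<n. (lorentz m (e i) v)\<^sup>2) = (\<Sum>i<n. (lorentz m (e i) (f l))\<^sup>2)"
      by (rule sum.cong) (auto simp: v_def lorentz_linear pe lorentz_commute[of m "e _" p])
    finally show ?thesis .
  qed
  then have "(\<Sum>l<n. \<Sum>i<n. (lorentz m (e i) (f l))\<^sup>2) \<le> (\<Sum>l<n. 1 + (lorentz m p (f l))\<^sup>2)"
    by (intro sum_mono) auto
  then show "Z \<le> n + K" unfolding Z_def K_def by (subst sum.swap) (simp add: sum.distrib)
  show "Z \<le> real n - 1 + H / qq x" if q: "0 < qq x"
  proof -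
    let ?q = "qq x"
    have b: "(\<Sum>l<n. (lorentz m (e i) (f l) - zz i x / ?q * lorentz m (hh x) (f l))\<^sup>2)
        \<le> 1 - (zz i x)\<^sup>2 / ?q" if i: "i < n" for i
    proof -
      define r where "r = zz i x / ?q"
      have rq: "r * ?q = zz i x" using q by (simp add: r_def)
      define v where "v = (\<lambda>j. e i j - r * hh x j)"
      have "(\<Sum>l<n. (lorentz m (f l) v)\<^sup>2) \<le> lorentz m v v"
        by (rule bessel_ineq[OF xx f])
           (simp add: v_def lorentz_linear xe lorentz_commute[of m x "hh x"] hh_self rq)
      also have "lorentz m v v = 1 - r * zz i x - r * (zz i x - r * ?q)"
        using i by (simp add: v_def lorentz_linear ee e_hh hh_hh lorentz_commute[of m "hh x" "e i"]
            algebra_simps)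
      also have "\<dots> = 1 - (zz i x)\<^sup>2 / ?q"
        unfolding rq by (simp add: r_def power2_eq_square)
      also have "(\<Sum>l<n. (lorentz m (f l) v)\<^sup>2)
          = (\<Sum>l<n. (lorentz m (e i) (f l) - r * lorentz m (hh x) (f l))\<^sup>2)"
        by (rule sum.cong) (auto simp: v_def lorentz_linear lorentz_commute[of m "f _"])
      finally show ?thesis by (simp add: r_def)
    qed
    have d: "(\<Sum>i<n. (lorentz m (e i) (f l) - zz i x / ?q * lorentz m (hh x) (f l))\<^sup>2)
        = (\<Sum>i<n. (lorentz m (e i) (f l))\<^sup>2) - (lorentz m (hh x) (f l))\<^sup>2 / ?q" for l
    proof -
      define h where "h = lorentz m (hh x) (f l)"
      have "(\<Sum>i<n. (lorentz m (e i) (f l) - zz i x / ?q * h)\<^sup>2)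
        = (\<Sum>i<n. (lorentz m (e i) (f l))\<^sup>2) - 2 * h / ?q * (\<Sum>i<n. zz i x * zz i (f l))
          + (h / ?q)\<^sup>2 * (\<Sum>i<n. (zz i x)\<^sup>2)"
        unfolding sum_distrib_left sum_subtractf[symmetric] sum.distrib[symmetric]
        by (rule sum.cong) (auto simp: power2_eq_square algebra_simps zz_def)
      also have "(\<Sum>i<n. zz i x * zz i (f l)) = h" by (simp add: h_def hh_left)
      also have "(\<Sum>i<n. (zz i x)\<^sup>2) = ?q" by (simp add: qq_def)
      also have "(\<Sum>i<n. (lorentz m (e i) (f l))\<^sup>2) - 2 * h / ?q * h + (h / ?q)\<^sup>2 * ?q
          = (\<Sum>i<n. (lorentz m (e i) (f l))\<^sup>2) - h\<^sup>2 / ?q"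
        using q by (simp add: power2_eq_square field_simps)
      finally show ?thesis by (simp add: h_def)
    qed
    have "(\<Sum>l<n. \<Sum>i<n. (lorentz m (e i) (f l) - zz i x / ?q * lorentz m (hh x) (f l))\<^sup>2)
        \<le> (\<Sum>i<n. 1 - (zz i x)\<^sup>2 / ?q)"
      by (subst sum.swap) (intro sum_mono b, simp)
    also have "\<dots> = real n - 1"
      using q by (simp add: sum_subtractf sum_divide_distrib[symmetric] qq_def[symmetric])
    also have "(\<Sum>l<n. \<Sum>i<n. (lorentz m (e i) (f l) - zz i x / ?q * lorentz m (hh x) (f l))\<^sup>2)
       = Z - H / ?q"
      unfolding d Z_def H_def sum_subtractf sum_divide_distrib[symmetric]
      by (subst sum.swap) simp
    finally show ?thesis by simp
  qed
qed

text \<open>Bessel's inequality for \<open>e\<close> at \<open>p\<close>, applied to the component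
  of \<open>x\<close> orthogonal to \<open>p\<close>.\<close>

lemma ss_nonneg:
  assumes x: "x \<in> hyp m" shows "0 \<le> ss x"
proof -
  define v where "v = (\<lambda>j. x j + lorentz m p x * p j)"
  have "(\<Sum>i<n. (lorentz m (e i) v)\<^sup>2) \<le> lorentz m v v"
    by (rule bessel_ineq[OF pp e]) (simp add: v_def lorentz_linear pp)
  also have "lorentz m v v = (cc x)\<^sup>2 - 1"
    using x by (simp add: v_def lorentz_linear pp power2_eq_square cc_def hyp_def
        lorentz_commute[of m x p])
  also have "(\<Sum>i<n. (lorentz m (e i) v)\<^sup>2) = qq x"
    unfolding qq_def by (rule sum.cong)
      (auto simp: v_def lorentz_linear pe zz_def lorentz_commute[of m "e _" p])
  finally show ?thesis by (simp add: ss_def)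
qed

text \<open>Trace of the Hessian of \<open>GG\<close> over the plane \<open>P\<close>.\<close>

definition hess where
  "hess x P = n * al x + 4 * N\<^sup>2 * EE x * trace_form m P (hh x) (hh x)
     + be x * (\<Sum>i<n. trace_form m P (e i) (e i)) + 2 * A * trace_form m P p p"

text \<open>Substituting \<open>(cc x)^2 = 1 + qq x + ss x\<close> separates the contribution of
  \<open>A * ss\<close> from the negative term and the radial convexity term of
  \<open>EE\<close>.\<close>

lemma hess_eq:
  "hess x P = 2 * (A * (n * ss x + n + trace_form m P p p - (\<Sum>i<n. trace_form m P (e i) (e i)))
     - N * EE x * (n * qq x + (\<Sum>i<n. trace_form m P (e i) (e i)))
     + 2 * N\<^sup>2 * EE x * trace_form m P (hh x) (hh x))"
  by (simp add: hess_def al_def be_def ss_def algebra_simps)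

lemma dv_eq:
  "dv (x, P) = S1 x * (be x * trace_form m P p (hh x) + ga x * trace_form m P p p)
     + S2 x * ((be x)\<^sup>2 * trace_form m P (hh x) (hh x)
         + 2 * be x * ga x * trace_form m P p (hh x) + (ga x)\<^sup>2 * trace_form m P p p)
     + TT x * hess x P"
  by (simp add: dv_def hess_def)

lemma qq_nonneg: "0 \<le> qq x" by (auto simp: qq_def intro!: sum_nonneg)

text \<open>Only the middle term of \<open>hess_eq\<close> can be negative. There
  \<open>EE x\<close> is at most 1, and \<open>Z <= n + qq x\<close> with \<open>qq x <= 1\<close>
  bounds the bracket by \<open>2 * n + 1\<close>.\<close>

lemma hess_ge_inside:
  assumes z: "(x, P) \<in> grassmann_bundle n m (hyp m)" and q: "qq x \<le> 1" and "0 \<le> A" "0 \<le> N"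
  shows "- (2 * N * (2 * n + 1)) \<le> hess x P"
proof -
  obtain f where f: "frame n m x f" and P: "P = plane_proj n f" and x: "x \<in> hyp m"
    using z by (auto simp: grassmann_bundle_def)
  define H K Z where "H = trace_form m P (hh x) (hh x)" and "K = trace_form m P p p"
    and "Z = (\<Sum>i<n. trace_form m P (e i) (e i))"
  have Z: "Z \<le> n + qq x" "Z \<le> n + K"
    using frame_estimates(1,2)[OF x f]
    by (auto simp: Z_def K_def P trace_form_plane_proj power2_eq_square)
  have H: "0 \<le> H" by (auto simp: H_def P trace_form_plane_proj intro!: sum_nonneg)
  have E: "0 \<le> EE x" "EE x \<le> 1" using \<open>0 \<le> N\<close> qq_nonneg[of x] by (auto simp: EE_def)
  have Z0: "0 \<le> Z" by (auto simp: Z_def P trace_form_plane_proj intro!: sum_nonneg)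
  have q0: "0 \<le> qq x" by (rule qq_nonneg)
  have "real n * qq x \<le> real n * 1" using q by (intro mult_left_mono) auto
  then have "n * qq x + Z \<le> 2 * n + 1" using Z q by simp
  moreover have "0 \<le> n * qq x + Z" using Z0 q0 by simp
  ultimately have "EE x * (n * qq x + Z) \<le> 1 * real (2 * n + 1)"
    using E by (intro mult_mono) auto
  then have "N * (EE x * (n * qq x + Z)) \<le> N * (2 * n + 1)"
    using \<open>0 \<le> N\<close> by (intro mult_left_mono) auto
  moreover have "0 \<le> A * (n * ss x + n + K - Z)"
    using \<open>0 \<le> A\<close> Z mult_nonneg_nonneg[OF of_nat_0_le_iff[of n] ss_nonneg[OF x]]
    by (intro mult_nonneg_nonneg) linarith+
  moreover have "0 \<le> N\<^sup>2 * (EE x * H)" using E H by (intro mult_nonneg_nonneg) auto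
  ultimately show ?thesis
    unfolding hess_eq H_def[symmetric] K_def[symmetric] Z_def[symmetric]
    by (simp add: mult.assoc)
qed

text \<open>With \<open>a = H / qq x\<close>, the squared length of the projection of the unit radial covector to
  \<open>P\<close>, the bound is linear in \<open>a\<close>: the radial convexity of \<open>EE\<close> wins for \<open>a = 1\<close>, the convexity of
  \<open>A * ss\<close> in the normal directions for \<open>a = 0\<close>.\<close>

lemma hess_ge_outside:
  assumes z: "(x, P) \<in> grassmann_bundle n m (hyp m)" and n: "1 \<le> n"
    and N: "N = 32 * n" and A: "A = 256 * n\<^sup>2" and q: "1 / 32 \<le> qq x" "qq x \<le> 7"
  shows "N * EE x \<le> hess x P"
proof -
  obtain f where f: "frame n m x f" and P: "P = plane_proj n f" and x: "x \<in> hyp m"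
    using z by (auto simp: grassmann_bundle_def)
  define H K Z where "H = trace_form m P (hh x) (hh x)" and "K = trace_form m P p p"
    and "Z = (\<Sum>i<n. trace_form m P (e i) (e i))"
  have q0: "0 < qq x" using q by simp
  define a where "a = H / qq x"
  have Z: "Z \<le> n + K" "Z \<le> real n - 1 + a"
    using frame_estimates(2)[OF x f] frame_estimates(3)[OF x f q0]
    by (auto simp: a_def Z_def H_def K_def P trace_form_plane_proj power2_eq_square)
  have a: "0 \<le> a" "H = qq x * a" using q0
    by (auto simp: a_def H_def P trace_form_plane_proj intro!: sum_nonneg divide_nonneg_pos)
  have K: "0 \<le> K" by (auto simp: K_def P trace_form_plane_proj intro!: sum_nonneg)
  define F where "F = N * EE x"
  have F: "0 \<le> F" "F \<le> N"
  proof -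
    have "0 \<le> N" by (simp add: N)
    then have "0 \<le> EE x" "EE x \<le> 1" using qq_nonneg[of x] by (auto simp: EE_def)
    then show "0 \<le> F" "F \<le> N"
      using \<open>0 \<le> N\<close> mult_left_mono[of "EE x" 1 N] by (auto simp: F_def)
  qed
  define r :: real where "r = real n"
  have r: "1 \<le> r" using n by (simp add: r_def)
  define w where "w = r * qq x"
  have rw: "r / 32 \<le> w" "w \<le> 7 * r"
    using mult_left_mono[OF q(1), of r] mult_left_mono[OF q(2), of r] r
    by (auto simp: w_def mult.commute)
  \<comment> \<open>Here \<open>64 * w = 2 * N * qq x\<close>, so the term with \<open>a\<close> is
    the radial convexity of \<open>EE\<close>. The claim is half of the estimate, apart from the
    nonnegative \<open>A * (r * ss x)\<close>.\<close>
  have main: "F * (1 / 2) \<le> F * (64 * w * a - w - Z) + A * (r + K - Z)"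
  proof (cases "1 \<le> a")
    case True
    have "(64 * w - 1) * 1 \<le> (64 * w - 1) * a"
    proof (rule mult_left_mono)
      show "0 \<le> 64 * w - 1" using rw r by linarith
    qed (rule True)
    then have "64 * w - 1 + a \<le> 64 * w * a"
      by (simp add: left_diff_distrib)
    then have "1 / 2 \<le> 64 * w * a - w - Z"
      using Z(2) rw r unfolding r_def[symmetric] by linarith
    then have "F * (1 / 2) \<le> F * (64 * w * a - w - Z)"
      using F by (intro mult_left_mono)
    moreover have "0 \<le> A * (r + K - Z)" using Z A by (simp add: r_def)
    ultimately show ?thesis by linarith
  next
    case False
    \<comment> \<open>The choice \<open>A = 8 * r * N\<close> lets the convexity of
      \<open>A * ss\<close> absorb \<open>8 * r * (1 - a)\<close> times \<open>F\<close>.\<close>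
    have "F * (8 * r) \<le> N * (8 * r)" using F r by (intro mult_right_mono) auto
    also have "\<dots> = A" by (simp add: N A r_def power2_eq_square)
    finally have "F * (8 * r) * (1 - a) \<le> A * (1 - a)"
      using False by (intro mult_right_mono) auto
    also have "\<dots> \<le> A * (r + K - Z)" using Z K A by (intro mult_left_mono) (auto simp: r_def)
    finally have 1: "F * (8 * r * (1 - a)) \<le> A * (r + K - Z)" by (simp add: mult.assoc)
    \<comment> \<open>The expression to be bounded is affine in \<open>a\<close>: the end
      \<open>a = 0\<close> needs \<open>w <= 7 * r\<close>, the end \<open>a = 1\<close> needs
      \<open>w >= r / 32\<close>. These products interpolate between the two.\<close>
    have "0 \<le> (1 - a) * (7 * r - w)" using False rw by (intro mult_nonneg_nonneg) auto
    moreover have "0 \<le> a * (63 * w - 63 / 32 * r)" using a rw by (intro mult_nonneg_nonneg) auto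
    moreover have "0 \<le> a * (r - 1)" "0 \<le> (1 - a) * r" using a r False by auto
    ultimately have "1 / 2 \<le> (64 * w * a - w - (r - 1 + a)) + 8 * r * (1 - a)"
      using a(1) False by (simp add: algebra_simps)
    also have "\<dots> \<le> (64 * w * a - w - Z) + 8 * r * (1 - a)"
      using Z by (simp add: r_def)
    finally have "F * (1 / 2) \<le> F * ((64 * w * a - w - Z) + 8 * r * (1 - a))"
      using F by (intro mult_left_mono)
    then show ?thesis using 1 by (simp add: distrib_left)
  qed
  have "hess x P = 2 * (A * (r * ss x) + (F * (64 * w * a - w - Z) + A * (r + K - Z)))"
    unfolding hess_eq H_def[symmetric] K_def[symmetric] Z_def[symmetric] r_def[symmetric] F_def w_def a(2)
    by (simp add: N r_def[symmetric] power2_eq_square algebra_simps)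
  moreover have "0 \<le> A * (r * ss x)" using A r ss_nonneg[OF x] by (auto simp: r_def)
  ultimately show ?thesis using main by (simp add: F_def)
qed

text \<open>The cutoff is constantly 1 here, so the \<open>S1\<close> term vanishes, and the
  \<open>S2\<close> term is a nonnegative multiple of the squared length of the gradient of
  \<open>GG\<close> projected to \<open>P\<close>.\<close>

lemma dv_ge:
  assumes z: "(x, P) \<in> grassmann_bundle n m (hyp m)" and c: "cc x \<le> c1"
  shows "sqpart (GG x) * hess x P \<le> dv (x, P)"
proof -
  obtain f where P: "P = plane_proj n f" using z by (auto simp: grassmann_bundle_def)
  have "1 \<le> uu x" using c c12 by (simp add: uu_def)
  note s = smoothstep_eq_1[OF this]
  have "(be x)\<^sup>2 * trace_form m P (hh x) (hh x) + 2 * be x * ga x * trace_form m P p (hh x)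
      + (ga x)\<^sup>2 * trace_form m P p p
    = (\<Sum>l<n. (be x * lorentz m (hh x) (f l) + ga x * lorentz m p (f l))\<^sup>2)"
    unfolding P trace_form_plane_proj sum_distrib_left sum.distrib[symmetric]
    by (rule sum.cong) (auto simp: power2_eq_square algebra_simps)
  also have "\<dots> \<ge> 0" by (auto intro!: sum_nonneg)
  finally show ?thesis
    by (simp add: dv_eq S1_def S2_def TT_def s)
qed

lemma dv_eq_0:
  assumes "GG x \<le> 0 \<or> c2 \<le> cc x" shows "dv (x, P) = 0"
proof -
  have "uu x \<le> 0" if "c2 \<le> cc x"
    using that c12 by (simp add: uu_def divide_nonpos_pos)
  then show ?thesis using assms
    by (auto simp: dv_eq S1_def S2_def TT_def sqpart_def smoothstep_eq_0)
qed

lemma XX_eq_0: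
  assumes "c2 \<le> cc x" shows "XX x = (\<lambda>i. 0)"
proof -
  have "uu x \<le> 0" using assms c12 by (simp add: uu_def divide_nonpos_pos)
  then show ?thesis by (simp add: XX_def TT_def smoothstep_eq_0)
qed

text \<open>The \<open>SOME\<close> in \<open>plane_div\<close> hides any regularity;
  \<open>dv\<close> is its continuous substitute, which yields measurability and boundedness on
  compact sets.\<close>

lemma continuous_dv: "continuous_on UNIV dv"
proof -
  have c: "continuous_on UNIV (\<lambda>z::(nat \<Rightarrow> real) \<times> (nat \<Rightarrow> nat \<Rightarrow> real). g (fst z))"
    if "C1_fun m g" for g
    by (rule continuous_on_compose2[OF C1_fun_imp_continuous_on[OF that, of UNIV]
          continuous_on_fst[OF continuous_on_id]]) auto
  have P: "continuous_on UNIV (\<lambda>z::(nat \<Rightarrow> real) \<times> (nat \<Rightarrow> nat \<Rightarrow> real). snd z a b)" for a b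
    by (rule continuous_on_product_then_coordinatewise[OF
          continuous_on_product_then_coordinatewise[OF continuous_on_snd[OF continuous_on_id]]])
  have t: "continuous_on UNIV (\<lambda>z::(nat \<Rightarrow> real) \<times> (nat \<Rightarrow> nat \<Rightarrow> real).
      trace_form m (snd z) (a (fst z)) (b (fst z)))"
    if "\<And>i. C1_fun m (\<lambda>x. a x i)" "\<And>i. C1_fun m (\<lambda>x. b x i)" for a b
    by (rule continuous_on_trace_form[OF P c[OF that(1)] c[OF that(2)]])
  note cs = c[OF C1_uu] c[OF C1_GG] c[OF C1_al] c[OF C1_be] c[OF C1_ga] c[OF C1_EE] c[OF C1_TT]
    t[of hh hh] t[of "\<lambda>_. p" hh] t[of "\<lambda>_. p" "\<lambda>_. p"] t[of "\<lambda>_. e _" "\<lambda>_. e _"]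
  show ?thesis
    unfolding dv_def case_prod_beta S1_def S2_def
    using c12
    by (intro continuous_on_add continuous_on_mult continuous_on_divide continuous_on_const
        continuous_on_power continuous_on_max continuous_on_sum
        continuous_on_smoothstep continuous_on_smoothstep_deriv
        continuous_on_sqpart cs C1_hh C1_fun_const) auto
qed

end

subsection \<open>Compactness and supports\<close>

text \<open>Tychonoff's theorem. Vectors are functions on all of \<open>nat\<close>, so coordinate
  bounds give compactness in the product topology.\<close>

lemma compact_fun:
  fixes K :: "'i \<Rightarrow> 'a::topological_space set"
  assumes "\<And>i. compact (K i)"
  shows "compact {f. \<forall>i. f i \<in> K i}"
proof -
  have "compactin (product_topology (\<lambda>i. euclidean) UNIV) (PiE UNIV K)"
    using assms by (simp add: compactin_PiE)
  then have "compact (PiE UNIV K)" by (simp add: euclidean_product_topology)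
  then show ?thesis by (simp add: PiE_UNIV_domain Pi_def)
qed

text \<open>Replaces the open condition \<open>x 0 > 0\<close> by a closed one.\<close>

lemma hyp_iff: "x \<in> hyp m \<longleftrightarrow> (\<forall>i>m. x i = 0) \<and> lorentz m x x = -1 \<and> 1 \<le> x 0"
  using hyp_x0_ge1[of x m] by (auto simp: hyp_def mink_def)

lemma closed_hyp: "closed (hyp m)"
proof -
  have c: "continuous_on UNIV (\<lambda>x::nat \<Rightarrow> real. x i)" for i
    by (rule continuous_on_product_coordinates)
  have eq: "hyp m = {x. (\<forall>i. i > m \<longrightarrow> x i = 0) \<and> lorentz m x x = -1 \<and> 1 \<le> x 0}"
    by (rule set_eqI) (simp add: hyp_iff)
  show ?thesis
    unfolding eq
    by (intro closed_Collect_conj closed_Collect_all closed_Collect_imp closed_Collect_eq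
        closed_Collect_le continuous_on_lorentz c continuous_on_const open_Collect_const)
qed

text \<open>Orthogonality to \<open>x\<close> and spatial Cauchy-Schwarz give
  \<open>v0^2 <= x0^2 - 1\<close>, and the unit length then bounds the other coordinates. This
  bounds frames over a ball.\<close>

lemma unit_tangent_abs_coord_le:
  assumes x: "x \<in> hyp m" and xv: "lorentz m x v = 0" and vv: "lorentz m v v = 1"
    and v: "v \<in> mink m"
  shows "\<bar>v j\<bar> \<le> x 0"
proof -
  let ?S = "\<lambda>a b. \<Sum>i\<in>{1..m}. a i * b i"
  have x0: "0 < x 0" using hyp_x0_ge1[OF x] by simp
  have "(?S x v)\<^sup>2 \<le> ?S x x * ?S v v"
    using Cauchy_Schwarz_ineq_sum[of x v "{1..m}"] by (simp add: power2_eq_square)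
  moreover have "?S x v = x 0 * v 0" "?S x x = x 0 * x 0 - 1" and vs: "?S v v = 1 + v 0 * v 0"
    using x xv vv by (auto simp: hyp_def lorentz_split)
  ultimately have "(x 0 * v 0)\<^sup>2 \<le> (x 0 * x 0 - 1) * (1 + v 0 * v 0)" by simp
  then have v0: "v 0 * v 0 \<le> x 0 * x 0 - 1" by (simp add: power2_eq_square algebra_simps)
  have "v j * v j \<le> x 0 * x 0"
  proof (cases "j \<in> {1..m}")
    case True
    then have "v j * v j \<le> ?S v v" by (intro member_le_sum) auto
    then show ?thesis using vs v0 by linarith
  next
    case False
    then consider "j = 0" | "j > m" by force
    then show ?thesis using v v0 by cases (auto simp: mink_def)
  qed
  then show ?thesis using x0
    by (metis abs_le_square_iff abs_of_pos power2_eq_square)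
qed

context barrier
begin

lemma compact_ball: "compact {x \<in> hyp m. cc x \<le> c}"
proof -
  define b where "b = 2 * p 0 * c"
  have p0: "1 \<le> p 0" using hyp_x0_ge1[OF p] .
  have "\<bar>x i\<bar> \<le> b" if "x \<in> hyp m" "cc x \<le> c" for x i
  proof -
    have "\<bar>x i\<bar> \<le> x 0" by (rule hyp_abs_coord_le[OF that(1)])
    also have "\<dots> \<le> 2 * p 0 * cc x" using hyp_x0_bound(1)[OF that(1) p] by (simp add: cc_def)
    also have "\<dots> \<le> b" using that p0 by (simp add: b_def)
    finally show ?thesis .
  qed
  then have eq: "{x \<in> hyp m. cc x \<le> c} =
      {x. \<forall>i. x i \<in> {-b..b}} \<inter> (hyp m \<inter> {x. cc x \<le> c})"
    by (auto simp: abs_le_iff) (meson neg_le_iff_le minus_le_iff)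
  have "closed {x. cc x \<le> c}"
    by (intro closed_Collect_le C1_fun_imp_continuous_on[OF C1_cc] continuous_on_const)
  then show ?thesis
    unfolding eq by (intro compact_Int_closed compact_fun compact_Icc closed_Int closed_hyp)
qed

text \<open>The bundle is the continuous image of the pairs of a point and a frame. These form a
  closed set with bounded coordinates once frames are normalised to 0 at indices from
  \<open>n\<close> on.\<close>

lemma compact_grassmann_bundle_ball:
  "compact (grassmann_bundle n m {x \<in> hyp m. cc x \<le> c})"
proof -
  let ?K = "{x \<in> hyp m. cc x \<le> c}"
  define b where "b = 2 * p 0 * c"
  define FS where "FS = {(x, f). x \<in> ?K \<and> frame n m x f \<and> (\<forall>l\<ge>n. \<forall>j. f l j = 0)}"
  have p0: "1 \<le> p 0" using hyp_x0_ge1[OF p] .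
  have b0: "x 0 \<le> b" if "x \<in> ?K" for x
  proof -
    have "x 0 \<le> 2 * p 0 * cc x" using hyp_x0_bound(1)[of x m p] that p by (simp add: cc_def)
    also have "\<dots> \<le> b" using that p0 by (simp add: b_def)
    finally show ?thesis .
  qed
  have bound: "f l j \<in> {-b..b}" if "(x, f) \<in> FS" for x f l j
  proof (cases "l < n")
    case True
    have "\<bar>f l j\<bar> \<le> x 0"
      using that True by (intro unit_tangent_abs_coord_le[of x m])
        (auto simp: FS_def frame_def tangent_def)
    then show ?thesis using b0[of x] that by (auto simp: FS_def)
  next
    case False
    then show ?thesis using b0[of x] hyp_x0_ge1[of x m] that by (auto simp: FS_def)
  qed
  have c1: "continuous_on UNIV (\<lambda>z::(nat \<Rightarrow> real) \<times> (nat \<Rightarrow> nat \<Rightarrow> real). fst z j)" for j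
    by (rule continuous_on_product_then_coordinatewise[OF continuous_on_fst[OF continuous_on_id]])
  have c2: "continuous_on UNIV (\<lambda>z::(nat \<Rightarrow> real) \<times> (nat \<Rightarrow> nat \<Rightarrow> real). snd z l j)" for l j
    by (rule continuous_on_product_then_coordinatewise[OF
          continuous_on_product_then_coordinatewise[OF continuous_on_snd[OF continuous_on_id]]])
  define A' where "A' = ?K \<times> {f :: nat \<Rightarrow> nat \<Rightarrow> real. \<forall>l. f l \<in> {g. \<forall>j. g j \<in> {-b..b}}}"
  let ?B = "{z. (\<forall>l. l < n \<longrightarrow> (\<forall>j. j > m \<longrightarrow> snd z l j = 0)) \<and>
       (\<forall>l. l < n \<longrightarrow> lorentz m (fst z) (snd z l) = 0) \<and>
       (\<forall>i. i < n \<longrightarrow> (\<forall>j. j < n \<longrightarrow> lorentz m (snd z i) (snd z j) = (if i = j then 1 else 0))) \<and>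
       (\<forall>l. l \<ge> n \<longrightarrow> (\<forall>j. snd z l j = 0))}"
  have 1: "FS \<subseteq> A'"
  proof
    fix z assume z: "z \<in> FS"
    then have "fst z \<in> ?K" by (auto simp: FS_def)
    then show "z \<in> A'" using bound[of "fst z" "snd z"] z by (simp add: A'_def mem_Times_iff)
  qed
  have 2: "FS = (?K \<times> UNIV) \<inter> ?B"
    by (auto simp: FS_def frame_def tangent_def mink_def)
  have 3: "A' \<subseteq> ?K \<times> UNIV" by (auto simp: A'_def)
  have "\<And>S A B C :: ((nat \<Rightarrow> real) \<times> (nat \<Rightarrow> nat \<Rightarrow> real)) set. S \<subseteq> A \<Longrightarrow> S = C \<inter> B \<Longrightarrow> A \<subseteq> C \<Longrightarrow> S = A \<inter> B"
    by blast
  from this[OF 1 2 3] have eq: "FS = A' \<inter> ?B" .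
  have "closed ?B"
    by (intro closed_Collect_conj closed_Collect_all closed_Collect_imp closed_Collect_eq
        continuous_on_lorentz c1 c2 continuous_on_const open_Collect_const)
  moreover have "compact A'"
    unfolding A'_def by (intro compact_Times compact_ball compact_fun compact_Icc)
  ultimately have FS: "compact FS" unfolding eq by (rule compact_Int_closed[rotated])
  have c3: "continuous_on UNIV (\<lambda>z::(nat \<Rightarrow> real) \<times> (nat \<Rightarrow> nat \<Rightarrow> real). flat (snd z l) j)" for l j
    using c2 by (cases "j = 0") (auto simp: flat_def intro!: continuous_intros)
  have "continuous_on UNIV (\<lambda>z::(nat \<Rightarrow> real) \<times> (nat \<Rightarrow> nat \<Rightarrow> real).
      (fst z, plane_proj n (snd z)))"
    unfolding plane_proj_def
    by (intro continuous_on_Pair continuous_on_fst continuous_on_id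
        continuous_on_coordinatewise_then_product continuous_on_sum continuous_on_mult c2 c3)
  then have "compact ((\<lambda>z. (fst z, plane_proj n (snd z))) ` FS)"
    by (rule compact_continuous_image[OF continuous_on_subset[OF _ subset_UNIV] FS])
  also have "(\<lambda>z. (fst z, plane_proj n (snd z))) ` FS = grassmann_bundle n m ?K"
  proof (intro equalityI subsetI)
    fix z assume "z \<in> grassmann_bundle n m ?K"
    then obtain x f where z: "z = (x, plane_proj n f)" and x: "x \<in> ?K" and f: "frame n m x f"
      by (auto simp: grassmann_bundle_def)
    define g where "g = (\<lambda>l. if l < n then f l else (\<lambda>j. 0))"
    have "(x, g) \<in> FS" using x f by (auto simp: FS_def frame_def g_def)
    moreover have "plane_proj n g = plane_proj n f"
      unfolding plane_proj_def g_def by (intro ext sum.cong) auto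
    ultimately show "z \<in> (\<lambda>z. (fst z, plane_proj n (snd z))) ` FS"
      unfolding z by (intro image_eqI[of _ _ "(x, g)"]) auto
  qed (auto simp: FS_def grassmann_bundle_def)
  finally show ?thesis .
qed

end

text \<open>By second countability the complement of the support is covered by countably many basic
  open sets of measure zero.\<close>

lemma AE_measure_support:
  fixes M :: "'a::second_countable_topology measure"
  assumes M: "sets M = sets (restrict_space borel U)"
  shows "AE x in M. x \<in> measure_support M"
proof -
  have sp: "space M = U" using sets_eq_imp_space_eq[OF M] by (simp add: space_restrict_space)
  obtain \<B> :: "'a set set" where \<B>: "countable \<B>" "topological_basis \<B>"
    using ex_countable_basis by blast
  define \<N> where "\<N> = {W \<in> \<B>. emeasure M (W \<inter> space M) = 0}"
  have openI: "W \<inter> U \<in> sets M" if "open W" for W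
    unfolding M using that by (auto simp: sets_restrict_space)
  have "W \<inter> space M \<in> null_sets M" if "W \<in> \<N>" for W
  proof -
    have "open W" using that \<B>(2) topological_basis_open by (auto simp: \<N>_def)
    then have "W \<inter> U \<in> sets M" by (rule openI)
    then show ?thesis using that by (auto simp: \<N>_def sp null_sets_def)
  qed
  then have null: "(\<Union>W\<in>\<N>. W \<inter> space M) \<in> null_sets M"
    using \<B>(1) by (intro null_sets_UN') (auto simp: \<N>_def)
  show ?thesis
  proof (rule AE_I'[OF null], clarsimp)
    fix x assume x: "x \<in> space M" "x \<notin> measure_support M"
    then obtain W where W: "open W" "x \<in> W" "emeasure M (W \<inter> space M) = 0"
      by (auto simp: measure_support_def zero_less_iff_neq_zero)
    obtain W' where W': "W' \<in> \<B>" "x \<in> W'" "W' \<subseteq> W"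
      by (rule topological_basisE[OF \<B>(2) W(1,2)])
    have "W \<inter> U \<in> sets M" using W(1) by (rule openI)
    then have "emeasure M (W' \<inter> space M) \<le> emeasure M (W \<inter> space M)"
      using W' by (intro emeasure_mono) (auto simp: sp)
    then have "W' \<in> \<N>" using W W' by (auto simp: \<N>_def)
    then show "\<exists>W\<in>\<N>. x \<in> W" using W' by auto
  qed
qed

subsection \<open>The doubling inequality\<close>

text \<open>The number \<open>3 / 64\<close> leaves \<open>1 / 32\<close>, the lower bound for
  \<open>qq\<close> in \<open>hess_ge_outside\<close>, after \<open>\<sigma> <= 1 / 64\<close> is
  subtracted.\<close>

lemma sinh_quarter: "3 / 64 \<le> (sinh (1 / 4 :: real))\<^sup>2" "(sinh (1 / 4 :: real))\<^sup>2 \<le> 1"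
proof -
  have 1: "5 / 4 \<le> exp (1 / 4 :: real)" using exp_ge_add_one_self[of "1 / 4 :: real"] by simp
  have 2: "3 / 4 \<le> exp (- (1 / 4) :: real)" using exp_ge_add_one_self[of "- (1 / 4) :: real"] by simp
  have inv: "exp (1 / 4 :: real) * exp (- (1 / 4)) = 1" by (simp add: exp_add[symmetric])
  have 3: "exp (- (1 / 4) :: real) \<le> 4 / 5"
    using mult_right_mono[OF 1, of "exp (- (1 / 4))"] inv by simp
  have 4: "exp (1 / 4 :: real) \<le> 4 / 3"
    using mult_left_mono[OF 2, of "exp (1 / 4)"] inv by simp
  have s: "9 / 40 \<le> sinh (1 / 4 :: real)" "sinh (1 / 4 :: real) \<le> 1"
    using 1 2 3 4 unfolding sinh_def by auto
  have "(9 / 40)\<^sup>2 \<le> (sinh (1 / 4 :: real))\<^sup>2" using s by (intro power_mono) auto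
  then show "3 / 64 \<le> (sinh (1 / 4 :: real))\<^sup>2" by (simp add: power2_eq_square)
  show "(sinh (1 / 4 :: real))\<^sup>2 \<le> 1" using s by (intro power_le_one) auto
qed

lemma sinh_sq_le_7: "(sinh (11 / 8 :: real))\<^sup>2 \<le> 7"
proof -
  have "sinh (11 / 8 :: real) \<le> exp (11 / 8) / 2" by (simp add: sinh_def)
  then have "(sinh (11 / 8 :: real))\<^sup>2 \<le> (exp (11 / 8) / 2)\<^sup>2" by (intro power_mono) auto
  also have "\<dots> = exp (11 / 4) / 4" by (simp add: power2_eq_square exp_add[symmetric])
  also have "\<dots> \<le> exp 3 / 4" by simp
  also have "exp 3 = exp (1::real) ^ 3" by (simp add: exp_of_nat_mult[symmetric])
  also have "\<dots> / 4 \<le> 3 ^ 3 / 4" using exp_le by (intro divide_right_mono power_mono) auto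
  finally show ?thesis by simp
qed

text \<open>\<open>B\<close> is the midpoint of the values of \<open>exp (- N * sinh^2)\<close> at
  radii \<open>5 / 4\<close> and \<open>11 / 8\<close>. The last inequality is strict in the limit
  \<open>\<sigma>\<close> to 0, so it persists for small positive \<open>\<sigma>\<close>.\<close>

lemma barrier_constants:
  fixes N A :: real
  assumes "0 < N"
  obtains B \<sigma> where "B < exp (- N * (sinh (5 / 4))\<^sup>2)" "0 < B" "0 < \<sigma>" "\<sigma> \<le> 1 / 64"
    "exp (- N * ((sinh (11 / 8))\<^sup>2 - \<sigma>)) + A * \<sigma> \<le> B"
proof -
  define a b where "a = exp (- N * (sinh (5 / 4))\<^sup>2)" and "b = exp (- N * (sinh (11 / 8 :: real))\<^sup>2)"
  have "(sinh (5 / 4 :: real))\<^sup>2 < (sinh (11 / 8))\<^sup>2" by (intro power_strict_mono) auto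
  then have ab: "b < a" using assms by (simp add: a_def b_def)
  have b0: "0 < b" by (simp add: b_def)
  define B where "B = (a + b) / 2"
  have B: "b < B" "B < a" "0 < B" using ab b0 by (auto simp: B_def)
  have "((\<lambda>\<sigma>. exp (- N * ((sinh (11 / 8))\<^sup>2 - \<sigma>)) + A * \<sigma>) \<longlongrightarrow>
      exp (- N * ((sinh (11 / 8))\<^sup>2 - 0)) + A * 0) (at_right 0)"
    by (intro tendsto_intros)
  then have "((\<lambda>\<sigma>. exp (- N * ((sinh (11 / 8))\<^sup>2 - \<sigma>)) + A * \<sigma>) \<longlongrightarrow> b) (at_right 0)"
    by (simp add: b_def)
  then have "\<forall>\<^sub>F \<sigma> in at_right 0. exp (- N * ((sinh (11 / 8))\<^sup>2 - \<sigma>)) + A * \<sigma> < B"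
    by (rule order_tendstoD(2)) (rule B)
  moreover have "\<forall>\<^sub>F \<sigma> in at_right (0::real). 0 < \<sigma>" by (rule eventually_at_right_less)
  moreover have "\<forall>\<^sub>F \<sigma> in at_right (0::real). \<sigma> < 1 / 64"
    by (rule order_tendstoD(2)[OF tendsto_ident_at]) simp
  ultimately have "\<forall>\<^sub>F \<sigma> in at_right 0. exp (- N * ((sinh (11 / 8))\<^sup>2 - \<sigma>)) + A * \<sigma> < B
      \<and> 0 < \<sigma> \<and> \<sigma> < 1 / 64"
    by (intro eventually_conj)
  then obtain \<sigma> where "exp (- N * ((sinh (11 / 8))\<^sup>2 - \<sigma>)) + A * \<sigma> < B" "0 < \<sigma>" "\<sigma> < 1 / 64"
    using eventually_happens'[OF trivial_limit_at_right_real] by blast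
  with B show thesis by (intro that[of B \<sigma>]) (auto simp: a_def)
qed

section \<open>Testing stationarity with the barrier field\<close>

context barrier
begin

lemma hball_eq: "0 \<le> s \<Longrightarrow> hball m s p = {x \<in> hyp m. cc x < cosh s}"
  by (auto simp: hball_def cc_def hdist_less_iff p)

lemma C1_vector_field_XX:
  assumes "c2 < cosh (3 / 2)"
  shows "C1_vector_field_cpt m (hball m (3 / 2) p) XX"
  unfolding C1_vector_field_cpt_def
proof (intro conjI ballI)
  let ?U = "hball m (3 / 2) p"
  show "XX x \<in> tangent m x" if "x \<in> ?U" for x
    using that by (intro XX_tangent) (simp add: hball_def)
  show "\<exists>W F. open W \<and> ?U \<subseteq> W \<and> C1_on m (W \<inter> mink m) F \<and> (\<forall>x\<in>?U. F x = XX x)"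
    by (rule exI[of _ UNIV], rule exI[of _ XX]) (auto intro!: C1_on_UNIV C1_XX)
  show "\<exists>K. compact K \<and> K \<subseteq> ?U \<and> (\<forall>x\<in>?U - K. XX x = (\<lambda>i. 0))"
  proof (intro exI[of _ "{x \<in> hyp m. cc x \<le> c2}"] conjI compact_ball ballI)
    show "{x \<in> hyp m. cc x \<le> c2} \<subseteq> ?U" using assms by (auto simp: hball_eq)
    show "XX x = (\<lambda>i. 0)" if "x \<in> ?U - {x \<in> hyp m. cc x \<le> c2}" for x
      using that by (intro XX_eq_0) (auto simp: hball_def)
  qed
qed

text \<open>\<open>dv\<close> is continuous and vanishes off the compact bundle over
  \<open>cc x <= c2\<close>, which lies in the open ball and so has finite measure.\<close>

lemma integrable_dv:
  assumes V: "sets V = sets (restrict_space borel (grassmann_bundle n m (hball m (3 / 2) p)))"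
    and fin: "\<And>K. compact K \<Longrightarrow> K \<subseteq> grassmann_bundle n m (hball m (3 / 2) p) \<Longrightarrow> emeasure V K < \<infinity>"
    and c2: "c2 < cosh (3 / 2)"
  shows "grassmann_bundle n m {x \<in> hyp m. cc x \<le> c2} \<in> sets V"
    and "emeasure V (grassmann_bundle n m {x \<in> hyp m. cc x \<le> c2}) < \<infinity>"
    and "integrable V dv"
proof -
  let ?U = "hball m (3 / 2) p" and ?K = "{x \<in> hyp m. cc x \<le> c2}"
  let ?G = "grassmann_bundle n m ?K"
  have G: "compact ?G" by (rule compact_grassmann_bundle_ball)
  have sub: "?G \<subseteq> grassmann_bundle n m ?U"
    using c2 by (auto simp: grassmann_bundle_def hball_eq)
  have sp: "space V = grassmann_bundle n m ?U"
    using sets_eq_imp_space_eq[OF V] by (simp add: space_restrict_space)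
  show GV: "?G \<in> sets V"
    unfolding V using sub borel_compact[OF G] by (auto simp: sets_restrict_space)
  show Gf: "emeasure V ?G < \<infinity>" by (rule fin[OF G sub])
  have meas: "dv \<in> borel_measurable V"
    unfolding measurable_cong_sets[OF V refl]
    by (intro measurable_restrict_space1 borel_measurable_continuous_onI continuous_dv)
  have "bounded (dv ` ?G)"
    by (intro compact_imp_bounded compact_continuous_image G
        continuous_on_subset[OF continuous_dv subset_UNIV])
  then obtain b where b: "\<And>z. z \<in> ?G \<Longrightarrow> norm (dv z) \<le> b"
    unfolding bounded_iff by blast
  show "integrable V dv"
  proof (rule integrableI_bounded_set[OF GV meas Gf, of b])
    show "AE z in V. z \<in> ?G \<longrightarrow> norm (dv z) \<le> b" using b by simp
    show "AE z in V. z \<notin> ?G \<longrightarrow> dv z = 0"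
    proof (rule AE_I2, clarify)
      fix x P assume "(x, P) \<in> space V" "(x, P) \<notin> ?G"
      then have "c2 \<le> cc x" by (auto simp: sp grassmann_bundle_def hball_def)
      then show "dv (x, P) = 0" by (intro dv_eq_0) simp
    qed
  qed
qed

text \<open>In the tube, \<open>qq x\<close> differs from \<open>(cc x)^2 - 1\<close> by less than
  \<open>\<sigma>\<close>, so bounds on the distance to \<open>p\<close> become bounds on
  \<open>qq\<close> in both directions and the estimates for \<open>hess\<close> apply.\<close>

lemma dv_lower_bound:
  fixes \<sigma> e1 :: real
  assumes n: "1 \<le> n" and N: "N = 32 * n" and A: "A = 256 * n\<^sup>2"
    and c1: "c1 = cosh (11 / 8)"
    and B: "B < exp (- N * (sinh (5 / 4))\<^sup>2)" "0 < B"
    and \<sigma>: "0 < \<sigma>" "\<sigma> \<le> 1 / 64" "exp (- N * ((sinh (11 / 8))\<^sup>2 - \<sigma>)) + A * \<sigma> \<le> B"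
    and z: "(x, P) \<in> grassmann_bundle n m (hyp m)" and s: "ss x < \<sigma>"
    and e1: "e1 = exp (- N * (sinh (5 / 4))\<^sup>2)"
  shows "cosh (11 / 8) < cc x \<or> cosh (1 / 4) \<le> cc x \<Longrightarrow> 0 \<le> dv (x, P)"
    and "cosh (1 / 4) \<le> cc x \<Longrightarrow> cc x < cosh (5 / 4) \<Longrightarrow> (e1 - B)\<^sup>2 * (N * e1) \<le> dv (x, P)"
    and "cc x < cosh (1 / 4) \<Longrightarrow> - ((1 + A)\<^sup>2 * (2 * N * (2 * n + 1))) \<le> dv (x, P)"
proof -
  have x: "x \<in> hyp m" using z by (auto simp: grassmann_bundle_def)
  have N0: "0 < N" "0 \<le> N" using n N by auto
  have A0: "0 \<le> A" by (simp add: A)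
  have s0: "0 \<le> ss x" by (rule ss_nonneg[OF x])
  have q: "qq x = (cc x)\<^sup>2 - 1 - ss x" by (simp add: ss_def)
  have c1': "1 \<le> cc x" using hyp_x0_bound(2)[OF x p] by (simp add: cc_def)
  have sinh_cosh: "(sinh r)\<^sup>2 = (cosh r)\<^sup>2 - 1" for r :: real by (simp add: cosh_square_eq)
  have q_le: "qq x \<le> (sinh r)\<^sup>2" if "cc x \<le> cosh r" for r
  proof -
    have "(cc x)\<^sup>2 \<le> (cosh r)\<^sup>2" using that c1' by (intro power_mono) auto
    then show ?thesis using s0 unfolding q sinh_cosh by simp
  qed
  have q_ge: "(sinh r)\<^sup>2 - \<sigma> \<le> qq x" if "cosh r \<le> cc x" for r
  proof -
    have "(cosh r)\<^sup>2 \<le> (cc x)\<^sup>2" using that by (intro power_mono) auto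
    then show ?thesis using s unfolding q sinh_cosh by simp
  qed
  have E1: "EE x \<le> 1" "0 \<le> EE x" using N0 qq_nonneg[of x] by (auto simp: EE_def)
  have hess0: "N * EE x \<le> hess x P" if "cosh (1 / 4) \<le> cc x" "cc x \<le> cosh (11 / 8)"
  proof (rule hess_ge_outside[OF z n N A])
    show "1 / 32 \<le> qq x" using q_ge[OF that(1)] sinh_quarter(1) \<sigma>(2) by linarith
    show "qq x \<le> 7" using q_le[OF that(2)] sinh_sq_le_7 by linarith
  qed
  have sq: "0 \<le> sqpart t" for t by (simp add: sqpart_def)
  have mono: "cosh (1 / 4 :: real) \<le> cosh (5 / 4)" "cosh (5 / 4 :: real) \<le> cosh (11 / 8)"
    by (simp_all add: cosh_real_nonneg_le_iff)
  show "0 \<le> dv (x, P)" if "cosh (11 / 8) < cc x \<or> cosh (1 / 4) \<le> cc x"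
  proof (cases "cc x \<le> cosh (11 / 8)")
    case True
    with that have "N * EE x \<le> hess x P" by (intro hess0) auto
    then have "0 \<le> hess x P" using mult_nonneg_nonneg[OF N0(2) E1(2)] by linarith
    then have "0 \<le> sqpart (GG x) * hess x P" using sq by simp
    also have "\<dots> \<le> dv (x, P)" using True c1 by (intro dv_ge[OF z]) simp
    finally show ?thesis .
  next
    case False
    \<comment> \<open>Where the cutoff may vary, \<open>GG\<close> is already nonpositive by the
      choice of \<open>\<sigma>\<close>, so the uncontrolled \<open>S1\<close> term is zero.\<close>
    then have "(sinh (11 / 8))\<^sup>2 - \<sigma> \<le> qq x" by (intro q_ge) simp
    then have "EE x \<le> exp (- N * ((sinh (11 / 8))\<^sup>2 - \<sigma>))"
      unfolding EE_def using N0 by simp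
    moreover have "A * ss x \<le> A * \<sigma>" using A0 s by (intro mult_left_mono) auto
    ultimately have "GG x \<le> 0" using \<sigma>(3) by (simp add: GG_def)
    then show ?thesis by (simp add: dv_eq_0)
  qed
  show "(e1 - B)\<^sup>2 * (N * e1) \<le> dv (x, P)" if "cosh (1 / 4) \<le> cc x" "cc x < cosh (5 / 4)"
  proof -
    have "e1 \<le> EE x" unfolding e1 EE_def using q_le[of "5 / 4"] that N0 by simp
    moreover have "0 \<le> A * ss x" using A0 s0 by simp
    ultimately have g: "e1 - B \<le> GG x" by (simp add: GG_def)
    have "(e1 - B)\<^sup>2 \<le> sqpart (GG x)"
      unfolding sqpart_def using g B by (intro power_mono) (auto simp: e1)
    moreover have "N * e1 \<le> hess x P"
      using hess0 that mono \<open>e1 \<le> EE x\<close> mult_left_mono[OF \<open>e1 \<le> EE x\<close> N0(2)] by linarith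
    ultimately have "(e1 - B)\<^sup>2 * (N * e1) \<le> sqpart (GG x) * hess x P"
      using N0 sq by (intro mult_mono) (auto simp: e1)
    also have "\<dots> \<le> dv (x, P)" using that mono c1 by (intro dv_ge[OF z]) simp
    finally show ?thesis .
  qed
  show "- ((1 + A)\<^sup>2 * (2 * N * (2 * n + 1))) \<le> dv (x, P)" if c: "cc x < cosh (1 / 4)"
  proof -
    have "qq x \<le> 1" using q_le[of "1 / 4"] c sinh_quarter(2) by linarith
    then have h: "- (2 * N * (2 * n + 1)) \<le> hess x P"
      using A0 N0 by (intro hess_ge_inside[OF z]) auto
    have "A * ss x \<le> A * 1" using A0 s \<sigma> by (intro mult_left_mono) auto
    then have "GG x \<le> 1 + A" using E1 B by (simp add: GG_def)
    then have "sqpart (GG x) \<le> (1 + A)\<^sup>2"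
      unfolding sqpart_def using A0 by (intro power_mono) auto
    then have "sqpart (GG x) * (2 * N * (2 * n + 1)) \<le> (1 + A)\<^sup>2 * (2 * N * (2 * n + 1))"
      using N0 by (intro mult_right_mono) auto
    moreover have "sqpart (GG x) * (- (2 * N * (2 * n + 1))) \<le> sqpart (GG x) * hess x P"
      using h sq by (intro mult_left_mono)
    moreover have "sqpart (GG x) * hess x P \<le> dv (x, P)"
      using c mono c1 by (intro dv_ge[OF z]) simp
    ultimately show ?thesis by linarith
  qed
qed

text \<open>The integral of \<open>dv\<close> vanishes by stationarity. Integrating its pointwise
  lower bound therefore gives
  \<open>\<delta> * measure V D <= (C0 + \<delta>) * measure V I\<close>.\<close>

lemma weight_doubling:
  fixes \<sigma> :: real
  assumes n: "1 \<le> n" and N: "N = 32 * n" and A: "A = 256 * n\<^sup>2"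
    and c1: "c1 = cosh (11 / 8)" and c2: "c2 = cosh (23 / 16)"
    and B: "B < exp (- N * (sinh (5 / 4))\<^sup>2)" "0 < B"
    and \<sigma>: "0 < \<sigma>" "\<sigma> \<le> 1 / 64" "exp (- N * ((sinh (11 / 8))\<^sup>2 - \<sigma>)) + A * \<sigma> \<le> B"
    and V: "sets V = sets (restrict_space borel (grassmann_bundle n m (hball m (3 / 2) p)))"
    and fin: "\<And>K. compact K \<Longrightarrow> K \<subseteq> grassmann_bundle n m (hball m (3 / 2) p) \<Longrightarrow> emeasure V K < \<infinity>"
    and st: "stationary n m (hball m (3 / 2) p) V"
    and tube: "AE z in V. ss (fst z) < \<sigma>"
    and \<delta>: "\<delta> = (exp (- N * (sinh (5 / 4))\<^sup>2) - B)\<^sup>2 * (N * exp (- N * (sinh (5 / 4))\<^sup>2))"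
    and C0: "C0 = (1 + A)\<^sup>2 * (2 * N * (2 * n + 1))"
  shows "emeasure V {z \<in> space V. cc (fst z) < cosh (5 / 4)}
    \<le> ennreal ((C0 + \<delta>) / \<delta>) * emeasure V {z \<in> space V. cc (fst z) < cosh (1 / 4)}"
proof -
  let ?U = "hball m (3 / 2) p"
  define D I where "D = {z \<in> space V. cc (fst z) < cosh (5 / 4)}"
    and "I = {z \<in> space V. cc (fst z) < cosh (1 / 4)}"
  define G where "G = grassmann_bundle n m {x \<in> hyp m. cc x \<le> c2}"
  have c2': "c2 < cosh (3 / 2)" by (simp add: c2 cosh_real_nonneg_less_iff)
  have sp: "space V = grassmann_bundle n m ?U"
    using sets_eq_imp_space_eq[OF V] by (simp add: space_restrict_space)
  have N0: "0 < N" using n N by simp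
  have \<delta>0: "0 < \<delta>" unfolding \<delta> using B N0 by (intro mult_pos_pos zero_less_power) auto
  have C0': "0 \<le> C0" unfolding C0 using N0 by (intro mult_nonneg_nonneg) auto
  have m1: "(\<lambda>z. cc (fst z)) \<in> borel_measurable V"
    unfolding measurable_cong_sets[OF V refl]
    by (intro measurable_restrict_space1 borel_measurable_continuous_onI
        continuous_on_compose2[OF C1_fun_imp_continuous_on[OF C1_cc, of UNIV]
          continuous_on_fst[OF continuous_on_id]]) auto
  have DV: "D \<in> sets V" and IV: "I \<in> sets V"
    unfolding D_def I_def using m1 by measurable
  note int = integrable_dv[OF V fin c2', folded G_def]
  have mono: "cosh (1 / 4 :: real) \<le> cosh (5 / 4)" "cosh (5 / 4 :: real) \<le> c2"
    by (simp_all add: cosh_real_nonneg_le_iff c2)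
  have ID: "I \<subseteq> D" using mono by (auto simp: D_def I_def)
  have DG: "D \<subseteq> G" using mono
    by (auto simp: D_def G_def sp grassmann_bundle_def hball_def)
  have Df: "emeasure V D < \<infinity>"
    using emeasure_mono[OF DG int(1)] int(2) by (rule le_less_trans)
  have If: "emeasure V I < \<infinity>"
    using emeasure_mono[OF ID DV] Df by (rule le_less_trans)
  have "integral\<^sup>L V dv = integral\<^sup>L V (plane_div n m XX)"
  proof (rule Bochner_Integration.integral_cong)
    fix z assume "z \<in> space V"
    then have "(fst z, snd z) \<in> grassmann_bundle n m (hyp m)"
      by (auto simp: sp grassmann_bundle_def hball_def)
    from plane_div_XX[OF this] show "dv z = plane_div n m XX z" by simp
  qed simp
  also have "\<dots> = 0" using st C1_vector_field_XX[OF c2'] unfolding stationary_def by blast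
  finally have zero: "integral\<^sup>L V dv = 0" .
  \<comment> \<open>Since \<open>I\<close> is contained in \<open>D\<close>, the left side is
    \<open>- C0\<close> on \<open>I\<close>, \<open>\<delta>\<close> on the rest of
    \<open>D\<close>, and 0 elsewhere: the three cases of \<open>dv_lower_bound\<close>.\<close>
  have "AE z in V. \<delta> * indicator D z - (C0 + \<delta>) * indicator I z \<le> dv z"
    using tube AE_space
  proof eventually_elim
    case (elim z)
    obtain x P where z: "z = (x, P)" by (cases z)
    have zb: "(x, P) \<in> grassmann_bundle n m (hyp m)"
      using elim(2) by (auto simp: z sp grassmann_bundle_def hball_def)
    have s: "ss x < \<sigma>" using elim(1) by (simp add: z)
    note lb = dv_lower_bound[OF n N A c1 B \<sigma> zb s refl]
    consider "cc x < cosh (1 / 4)" | "cosh (1 / 4) \<le> cc x" "cc x < cosh (5 / 4)"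
      | "cosh (1 / 4) \<le> cc x" "cosh (5 / 4) \<le> cc x"
      by linarith
    then show ?case
    proof cases
      case 1
      then have "z \<in> I" "z \<in> D" using elim(2) mono by (auto simp: D_def I_def z)
      then show ?thesis using lb(3)[OF 1] by (simp add: z C0)
    next
      case 2
      then have "z \<notin> I" "z \<in> D" using elim(2) by (auto simp: D_def I_def z)
      then show ?thesis using lb(2)[OF 2] by (simp add: z \<delta>)
    next
      case 3
      then have "z \<notin> I" "z \<notin> D" by (auto simp: D_def I_def z)
      then show ?thesis using lb(1) 3 by (simp add: z)
    qed
  qed
  moreover have Di: "integrable V (indicator D :: _ \<Rightarrow> real)" "integrable V (indicator I :: _ \<Rightarrow> real)"
    using DV IV Df If by auto
  ultimately have "(\<integral>z. \<delta> * indicator D z - (C0 + \<delta>) * indicator I z \<partial>V) \<le> integral\<^sup>L V dv"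
    using int(3) by (intro integral_mono_AE) auto
  moreover have "(\<integral>z. \<delta> * indicator D z - (C0 + \<delta>) * indicator I z \<partial>V)
      = \<delta> * measure V D - (C0 + \<delta>) * measure V I"
    using Di DV IV by (simp add: Int_absorb2 sets.sets_into_space)
  ultimately have "\<delta> * measure V D \<le> (C0 + \<delta>) * measure V I" using zero by simp
  then have "measure V D \<le> (C0 + \<delta>) / \<delta> * measure V I"
    using \<delta>0 by (simp add: field_simps)
  then have "ennreal (measure V D) \<le> ennreal ((C0 + \<delta>) / \<delta> * measure V I)" by (rule ennreal_leI)
  also have "\<dots> = ennreal ((C0 + \<delta>) / \<delta>) * ennreal (measure V I)"
    using \<delta>0 C0' by (intro ennreal_mult) auto
  finally show ?thesis
    using Df If unfolding D_def[symmetric] I_def[symmetric]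
    by (simp add: emeasure_eq_ennreal_measure less_top)
qed

end

theorem theorem1p3:
  fixes n :: nat
  assumes "n \<ge> 2"
  shows "\<exists>\<epsilon> C :: real. \<epsilon> > 0 \<and> C \<ge> 0 \<and>
    (\<forall>k \<ge> 1. \<forall>L p V.
       totally_geodesic_hyp n (n + k) L \<and> p \<in> L \<and>
       integral_varifold n (n + k) (hball (n + k) (3/2) p) V \<and>
       stationary n (n + k) (hball (n + k) (3/2) p) V \<and>
       measure_support (weight_measure (hball (n + k) (3/2) p) V) \<inter> hball (n + k) (3/2) p
         \<subseteq> {x \<in> hyp (n + k). hdist_set (n + k) x L < \<epsilon>}
       \<longrightarrow>
       emeasure (weight_measure (hball (n + k) (3/2) p) V) (hball (n + k) (5/4) p)
         \<le> ennreal C * emeasure (weight_measure (hball (n + k) (3/2) p) V) (hball (n + k) (1/4) p))"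
proof -
  \<comment> \<open>The values required by \<open>hess_ge_outside\<close>. All constants are fixed
    from \<open>n\<close> before \<open>k\<close> is introduced, whence the independence of the
    codimension.\<close>
  define N A :: real where "N = 32 * n" and "A = 256 * n\<^sup>2"
  have N0: "0 < N" using assms by (simp add: N_def)
  obtain B \<sigma> where B: "B < exp (- N * (sinh (5 / 4))\<^sup>2)" "0 < B"
    and \<sigma>: "0 < \<sigma>" "\<sigma> \<le> 1 / 64" "exp (- N * ((sinh (11 / 8))\<^sup>2 - \<sigma>)) + A * \<sigma> \<le> B"
    using barrier_constants[OF N0, of A] by metis
  define \<delta> where "\<delta> = (exp (- N * (sinh (5 / 4))\<^sup>2) - B)\<^sup>2 * (N * exp (- N * (sinh (5 / 4))\<^sup>2))"
  define C0 where "C0 = (1 + A)\<^sup>2 * (2 * N * (2 * n + 1))"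
  \<comment> \<open>With this radius, \<open>sinh^2\<close> of the distance to \<open>L\<close> is
    below \<open>\<sigma>\<close> throughout the tube.\<close>
  define \<epsilon> where "\<epsilon> = arsinh (sqrt \<sigma>)"
  have \<epsilon>: "0 < \<epsilon>" "(cosh \<epsilon>)\<^sup>2 = \<sigma> + 1"
    using \<sigma> by (simp_all add: \<epsilon>_def cosh_square_eq)
  have \<delta>0: "0 < \<delta>" unfolding \<delta>_def using B N0 by (intro mult_pos_pos zero_less_power) auto
  have C0': "0 \<le> C0" unfolding C0_def using N0 by (intro mult_nonneg_nonneg) auto
  show ?thesis
  proof (rule exI[of _ \<epsilon>], rule exI[of _ "(C0 + \<delta>) / \<delta>"], intro conjI allI impI)
    show "\<epsilon> > 0" by (rule \<epsilon>)
    show "(C0 + \<delta>) / \<delta> \<ge> 0" using \<delta>0 C0' by simp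
    fix k L p V
    define m where "m = n + k"
    let ?U = "hball (n + k) (3 / 2) p"
    assume "totally_geodesic_hyp n (n + k) L \<and> p \<in> L \<and>
       integral_varifold n (n + k) ?U V \<and> stationary n (n + k) ?U V \<and>
       measure_support (weight_measure ?U V) \<inter> ?U
         \<subseteq> {x \<in> hyp (n + k). hdist_set (n + k) x L < \<epsilon>}"
    then have L: "totally_geodesic_hyp n m L" and pL: "p \<in> L"
      and iv: "integral_varifold n m ?U V" and st: "stationary n m (hball m (3 / 2) p) V"
      and supp: "measure_support (weight_measure ?U V) \<inter> ?U \<subseteq> {x \<in> hyp m. hdist_set m x L < \<epsilon>}"
      by (auto simp: m_def)
    have Lh: "L \<subseteq> hyp m" using L by (simp add: totally_geodesic_hyp_def)
    then have p: "p \<in> hyp m" using pL by auto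
    obtain e where e: "frame n m p e"
      and eL: "\<And>y. y \<in> L \<Longrightarrow> (\<Sum>i<n. (lorentz m (e i) y)\<^sup>2) = (lorentz m p y)\<^sup>2 - 1"
      using totally_geodesic_frame[OF L pL] by blast
    \<comment> \<open>The cutoff acts between the radii \<open>11 / 8\<close> and
      \<open>23 / 16\<close>, so the field has compact support in the ball of radius
      \<open>3 / 2\<close>.\<close>
    interpret barrier n m p e N A B "cosh (11 / 8)" "cosh (23 / 16)"
      by unfold_locales (use p e in \<open>auto simp: cosh_real_nonneg_less_iff\<close>)
    have V: "sets V = sets (restrict_space borel (grassmann_bundle n m ?U))"
      using iv unfolding integral_varifold_def by auto
    have fin: "emeasure V K < \<infinity>" if "compact K" "K \<subseteq> grassmann_bundle n m ?U" for K
      using iv that unfolding integral_varifold_def by blast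
    have sp: "space V = grassmann_bundle n m ?U"
      using sets_eq_imp_space_eq[OF V] by (simp add: space_restrict_space)
    have fstm: "fst \<in> measurable V (restrict_space borel ?U)"
    proof (rule measurable_restrict_space2)
      show "fst \<in> space V \<rightarrow> ?U" by (auto simp: sp grassmann_bundle_def)
      show "fst \<in> borel_measurable V"
        unfolding measurable_cong_sets[OF V refl]
        by (intro measurable_restrict_space1 borel_measurable_continuous_onI
            continuous_on_fst continuous_on_id)
    qed
    \<comment> \<open>The hypothesis confines only the support, but almost every point lies in it;
      pulling back along \<open>fst\<close> gives the tube condition almost everywhere for
      \<open>V\<close>.\<close>
    have "AE x in weight_measure ?U V. x \<in> measure_support (weight_measure ?U V)"
      by (rule AE_measure_support[of _ ?U]) (simp add: weight_measure_def)
    then have "AE z in V. fst z \<in> measure_support (weight_measure ?U V)"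
      unfolding weight_measure_def by (rule AE_distrD[OF fstm])
    then have tube: "AE z in V. ss (fst z) < \<sigma>"
      using AE_space
    proof eventually_elim
      case (elim z)
      have "fst z \<in> ?U" using elim(2) by (auto simp: sp grassmann_bundle_def)
      then have x: "fst z \<in> hyp m" "hdist_set m (fst z) L < \<epsilon>" using supp elim(1) by auto
      have "(lorentz m p (fst z))\<^sup>2 - (\<Sum>i<n. (lorentz m (e i) (fst z))\<^sup>2) < \<sigma> + 1"
        using near_totally_geodesic[OF x(1) pL Lh e eL x(2)] \<epsilon> by simp
      then show ?case by (simp add: ss_def cc_def qq_def zz_def)
    qed
    have ball: "emeasure (weight_measure ?U V) (hball m s p)
        = emeasure V {z \<in> space V. cc (fst z) < cosh s}" if s: "0 \<le> s" "s \<le> 3 / 2" for s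
    proof -
      have c: "cosh s \<le> cosh (3 / 2)" using s by (simp add: cosh_real_nonneg_le_iff)
      have "open {x. cc x < cosh s}"
        by (intro open_Collect_less C1_fun_imp_continuous_on[OF C1_cc] continuous_on_const)
      moreover have "hball m s p = ?U \<inter> {x. cc x < cosh s}"
        using s c by (auto simp: hball_eq m_def[symmetric])
      ultimately have "hball m s p \<in> sets (restrict_space borel ?U)"
        by (auto simp: sets_restrict_space)
      then have "emeasure (weight_measure ?U V) (hball m s p) = emeasure V (fst -` hball m s p \<inter> space V)"
        unfolding weight_measure_def by (rule emeasure_distr[OF fstm])
      also have "fst -` hball m s p \<inter> space V = {z \<in> space V. cc (fst z) < cosh s}"
        using s c by (auto simp: sp hball_eq m_def[symmetric] grassmann_bundle_def)
      finally show ?thesis .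
    qed
    have "emeasure V {z \<in> space V. cc (fst z) < cosh (5 / 4)}
      \<le> ennreal ((C0 + \<delta>) / \<delta>) * emeasure V {z \<in> space V. cc (fst z) < cosh (1 / 4)}"
      by (rule weight_doubling[OF _ N_def A_def refl refl B \<sigma> V[folded m_def] fin[folded m_def] st tube
            \<delta>_def C0_def]) (use assms in auto)
    then show "emeasure (weight_measure ?U V) (hball (n + k) (5 / 4) p)
      \<le> ennreal ((C0 + \<delta>) / \<delta>) * emeasure (weight_measure ?U V) (hball (n + k) (1 / 4) p)"
      using ball[of "5 / 4"] ball[of "1 / 4"] by (simp add: m_def)
  qed
qed

end
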